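(* Let $\mu_+=\int x f_+(x)\,dx$ and $\mu_-=\int x f_-(x)\,dx$ and assume $\mu_+>\mu_-$. With $\mu_+,\mu_-$ known, there exists a Monte Carlo algorithm for the clustering problem with perfect oracle and side information with query complexity $O\big(\frac{k^2\log n}{(\mu_+-\mu_-)^2}\big)$, and there exists a Las Vegas algorithm with expected query complexity $O\big(n+\frac{k^2\log n}{(\mu_+-\mu_-)^2}\big)$ even when $\mu_+,\mu_-$ are unknown.
   Context: Clustering problem: the vertex set is $V=[n]$, partitioned into $k$ unknown nonempty clusters (the algorithms do not know $k$). Perfect oracle: a query is a pair $\{u,v\}$, answered $+1$ if $u,v$ are in the same cluster and $-1$ otherwise; queries may be adaptive. Side information: the algorithm is given a symmetric matrix $W=(w_{u,v})$ whose off-diagonal entries are independent $[0,1]$-valued random variables, $w_{u,v}\sim f_+$ if $u,v$ are in the same cluster and $w_{u,v}\sim f_-$ otherwise, where $f_+,f_-$ are unknown distributions (densities or mass functions). A Monte Carlo algorithm recovers the clusters correctly with high probability; a Las Vegas algorithm always recovers the clusters correctly. *)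

theory Defs
  imports "HOL-Probability.Probability"
begin

definition pairs :: "nat \<Rightarrow> nat set set" where
  "pairs n = {{u, v} | u v. u \<in> {1..n} \<and> v \<in> {1..n} \<and> u \<noteq> v}"

text \<open>The perfect oracle for a clustering \<open>P\<close>, on an unordered pair \<open>e = {u, v}\<close>:
  \<open>True\<close> encodes the answer \<open>+1\<close>, \<open>False\<close> the answer \<open>-1\<close>.\<close>

definition same_cluster :: "nat set set \<Rightarrow> nat set \<Rightarrow> bool" where
  "same_cluster P e \<longleftrightarrow> (\<exists>C\<in>P. e \<subseteq> C)"

text \<open>Adaptive querying is modelled by finite decision trees: \<open>Query e s t\<close> queries the pair \<open>e\<close>
  and continues with \<open>s\<close> on answer \<open>+1\<close> and with \<open>t\<close> on answer \<open>-1\<close>; \<open>Output Q\<close> stops and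
  returns the clustering \<open>Q\<close>.\<close>

datatype qtree = Output "nat set set" | Query "nat set" qtree qtree

primrec queried :: "qtree \<Rightarrow> nat set set" where
  "queried (Output Q) = {}"
| "queried (Query e s t) = insert e (queried s \<union> queried t)"

primrec result :: "nat set set \<Rightarrow> qtree \<Rightarrow> nat set set" where
  "result P (Output Q) = Q"
| "result P (Query e s t) = (if same_cluster P e then result P s else result P t)"

primrec num_queries :: "nat set set \<Rightarrow> qtree \<Rightarrow> nat" where
  "num_queries P (Output Q) = 0"
| "num_queries P (Query e s t) =
     Suc (if same_cluster P e then num_queries P s else num_queries P t)"

text \<open>The symmetric matrix \<open>W\<close> is represented by its off-diagonal entries, indexed by unordered
  pairs: \<open>w\<^sub>u\<^sub>v = W {u, v}\<close>. The second argument of an algorithm is its internal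
  randomness, a uniform real number in \<open>[0,1]\<close> independent of \<open>W\<close>.\<close>

type_synonym side_info = "nat set \<Rightarrow> real"
type_synonym algorithm = "side_info \<Rightarrow> real \<Rightarrow> qtree"

definition valid_algorithm :: "nat \<Rightarrow> algorithm \<Rightarrow> bool" where
  "valid_algorithm n A \<longleftrightarrow>
     (\<lambda>(W, r). A W r) \<in> (\<Pi>\<^sub>M e\<in>pairs n. borel) \<Otimes>\<^sub>M borel \<rightarrow>\<^sub>M count_space UNIV \<and>
     (\<forall>W r. queried (A W r) \<subseteq> pairs n)"

definition unit_distribution :: "real measure \<Rightarrow> bool" where
  "unit_distribution D \<longleftrightarrow> prob_space D \<and> sets D = sets borel \<and> (AE x in D. x \<in> {0..1})"

definition mean :: "real measure \<Rightarrow> real" where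
  "mean D = (\<integral>x. x \<partial>D)"

definition clustering_instance ::
  "nat \<Rightarrow> nat \<Rightarrow> nat set set \<Rightarrow> real measure \<Rightarrow> real measure \<Rightarrow> bool" where
  "clustering_instance n k P Dp Dm \<longleftrightarrow>
     n \<ge> 1 \<and> partition_on {1..n} P \<and> card P = k \<and> unit_distribution Dp \<and> unit_distribution Dm"

definition side_info_measure ::
  "nat \<Rightarrow> nat set set \<Rightarrow> real measure \<Rightarrow> real measure \<Rightarrow> side_info measure" where
  "side_info_measure n P Dp Dm = (\<Pi>\<^sub>M e\<in>pairs n. if same_cluster P e then Dp else Dm)"

definition run_measure ::
  "nat \<Rightarrow> nat set set \<Rightarrow> real measure \<Rightarrow> real measure \<Rightarrow> (side_info \<times> real) measure" where
  "run_measure n P Dp Dm = side_info_measure n P Dp Dm \<Otimes>\<^sub>M uniform_measure lborel {0..1}"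

definition inputs :: "nat \<Rightarrow> (side_info \<times> real) set" where
  "inputs n = (pairs n \<rightarrow>\<^sub>E {0..1}) \<times> {0..1}"

definition success_prob ::
  "nat \<Rightarrow> nat set set \<Rightarrow> real measure \<Rightarrow> real measure \<Rightarrow> algorithm \<Rightarrow> real" where
  "success_prob n P Dp Dm A =
     measure (run_measure n P Dp Dm)
       {(W, r) \<in> space (run_measure n P Dp Dm). result P (A W r) = P}"

definition expected_queries ::
  "nat \<Rightarrow> nat set set \<Rightarrow> real measure \<Rightarrow> real measure \<Rightarrow> algorithm \<Rightarrow> ennreal" where
  "expected_queries n P Dp Dm A =
     (\<integral>\<^sup>+ (W, r). of_nat (num_queries P (A W r)) \<partial>run_measure n P Dp Dm)"

end

theory Submission
  imports Defs
begin

text \<open>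
  Both algorithms process the vertices \<open>1, \<dots>, n\<close> in this order and maintain the clusters found so
  far; a new vertex \<open>v\<close> is compared with a cluster \<open>C\<close> by the single query \<open>{Min C, v}\<close>. As long as no
  mistake is made, the current clusters are the traces of the true ones on \<open>{1..<v}\<close>. These traces do
  not depend on the side information, so Hoeffding's inequality applies to the sums of \<open>w\<^sub>u\<^sub>v\<close> over
  \<open>u\<close> in a trace, and a union bound over the at most \<open>n k\<close> pairs of a vertex and a trace suffices.

  Monte Carlo: with \<open>\<Delta> = \<mu>\<^sub>+ - \<mu>\<^sub>-\<close>, a cluster with at least \<open>m \<approx> log n / \<Delta>\<^sup>2\<close> members absorbs, without
  any query, every vertex whose average weight to it exceeds \<open>(\<mu>\<^sub>+ + \<mu>\<^sub>-) / 2\<close>; all other vertices are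
  compared with all clusters. A vertex that turns out to belong to such a large cluster reveals an
  error, and the algorithm gives up. Hence at most \<open>k m + 1\<close> vertices ever cause queries, for every
  side information.

  Las Vegas: every vertex is compared with the clusters until a match is found, starting with the
  cluster of largest lower confidence bound, which is the average weight minus
  \<open>sqrt (2 log n / |C|)\<close>. Whp the bound of a wrong cluster of any size is below \<open>\<mu>\<^sub>-\<close>, and the bound of
  the right one is above \<open>\<mu>\<^sub>-\<close> as soon as it has \<open>8 log n / \<Delta>\<^sup>2\<close> members. Then one query is enough,
  and \<open>\<Delta>\<close> need not be known.
\<close>

section \<open>Sequential clustering by decision trees\<close>

primrec locate :: "nat \<Rightarrow> nat set list \<Rightarrow> (nat set option \<Rightarrow> qtree) \<Rightarrow> qtree" where
  "locate v [] f = f None"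
| "locate v (C # Cs) f = Query {Min C, v} (f (Some C)) (locate v Cs f)"

definition extend :: "nat \<Rightarrow> nat set \<Rightarrow> nat set set \<Rightarrow> nat set set" where
  "extend v C Q = insert (insert v C) (Q - {C})"

text \<open>\<open>skip v Q\<close> assigns \<open>v\<close> to a cluster without a query, \<open>ord v Q\<close> is the order of the
  comparisons, and \<open>abort C\<close> stops the run with the junk output \<open>{}\<close> when a query puts \<open>v\<close> into \<open>C\<close>.\<close>

primrec cluster_tree :: "(nat \<Rightarrow> nat set set \<Rightarrow> nat set option) \<Rightarrow>
    (nat \<Rightarrow> nat set set \<Rightarrow> nat set list) \<Rightarrow> (nat set \<Rightarrow> bool) \<Rightarrow> nat list \<Rightarrow> nat set set \<Rightarrow> qtree" where
  "cluster_tree skip ord abort [] Q = Output Q"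
| "cluster_tree skip ord abort (v # vs) Q =
     (case skip v Q of
        Some C \<Rightarrow> cluster_tree skip ord abort vs (extend v C Q)
      | None \<Rightarrow> locate v (ord v Q)
          (\<lambda>x. case x of
             None \<Rightarrow> cluster_tree skip ord abort vs (insert {v} Q)
           | Some C \<Rightarrow> if abort C then Output {}
                       else cluster_tree skip ord abort vs (extend v C Q)))"

abbreviation matching :: "nat set set \<Rightarrow> nat \<Rightarrow> nat set list \<Rightarrow> nat set option" where
  "matching P v \<equiv> List.find (\<lambda>C. same_cluster P {Min C, v})"

lemma result_locate: "result P (locate v Cs f) = result P (f (matching P v Cs))"
  by (induction Cs) auto

lemma num_queries_locate_le:
  "num_queries P (locate v Cs f) \<le> length Cs + num_queries P (f (matching P v Cs))"
  by (induction Cs) auto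

lemma queried_locate:
  "queried (locate v Cs f) \<subseteq>
     (\<lambda>C. {Min C, v}) ` set Cs \<union> queried (f None) \<union> (\<Union>C\<in>set Cs. queried (f (Some C)))"
  by (induction Cs) auto

lemma num_queries_eq_0: "queried t = {} \<Longrightarrow> num_queries P t = 0"
  by (cases t) auto

section \<open>Traces of the true clusters on the vertices before the current one\<close>

definition prefix_clusters :: "nat set set \<Rightarrow> nat \<Rightarrow> nat set set" where
  "prefix_clusters P v = (\<lambda>C. C \<inter> {1..<v}) ` P - {{}}"

lemma prefix_clusters_1 [simp]: "prefix_clusters P (Suc 0) = {}"
  by (auto simp: prefix_clusters_def)

lemma prefix_clusters_all:
  assumes "partition_on {1..n} P"
  shows "prefix_clusters P (Suc n) = P"
proof -
  have "C \<inter> {1..<Suc n} = C" if "C \<in> P" for C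
  proof -
    have "C \<subseteq> {1..n}" using partition_onD1[OF assms] that by blast
    then show ?thesis by force
  qed
  then have "(\<lambda>C. C \<inter> {1..<Suc n}) ` P = P" by (simp cong: image_cong)
  then show ?thesis
    using assms by (auto simp: prefix_clusters_def partition_on_def)
qed

lemma finite_partition: "partition_on {1..n::nat} P \<Longrightarrow> finite P"
  using finite_elements by blast

lemma finite_prefix_clusters: "finite P \<Longrightarrow> finite (prefix_clusters P v)"
  by (simp add: prefix_clusters_def)

lemma card_prefix_clusters_le: "finite P \<Longrightarrow> card (prefix_clusters P v) \<le> card P"
  unfolding prefix_clusters_def by (meson card_Diff1_le card_image_le order_trans)

lemma partition_cluster_unique:
  assumes "partition_on A P" "C \<in> P" "D \<in> P" "x \<in> C" "x \<in> D"
  shows "C = D"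
  using assms by (auto simp: partition_on_def disjoint_def)

text \<open>\<open>Min C\<close> lies in the true cluster that \<open>C\<close> is a trace of, and
  in no other. This is why one query per cluster decides membership in an error-free run.\<close>

lemma same_cluster_Min_iff:
  assumes P: "partition_on {1..n} P" and D: "D \<in> P" "v \<in> D" and C: "C \<in> prefix_clusters P v"
  shows "same_cluster P {Min C, v} \<longleftrightarrow> C = D \<inter> {1..<v}"
proof -
  obtain E where E: "E \<in> P" "C = E \<inter> {1..<v}" "C \<noteq> {}"
    using C by (auto simp: prefix_clusters_def)
  then have "finite C" by auto
  then have M: "Min C \<in> C" using E(3) by (rule Min_in)
  show ?thesis
  proof
    assume "same_cluster P {Min C, v}"
    then obtain F where F: "F \<in> P" "Min C \<in> F" "v \<in> F"
      by (auto simp: same_cluster_def)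
    then have "F = E" "F = D"
      using partition_cluster_unique[OF P] E M D by blast+
    then show "C = D \<inter> {1..<v}" using E by simp
  next
    assume "C = D \<inter> {1..<v}"
    then show "same_cluster P {Min C, v}"
      using D M by (auto simp: same_cluster_def)
  qed
qed

text \<open>Passing \<open>v\<close> changes only the trace of the cluster of \<open>v\<close>. The
  state update of \<open>cluster_tree\<close> is thus the true one whenever \<open>v\<close> is
  placed correctly.\<close>

lemma prefix_clusters_Suc:
  assumes P: "partition_on {1..n} P" and D: "D \<in> P" "v \<in> D"
  shows "prefix_clusters P (Suc v) =
    (if D \<inter> {1..<v} = {} then insert {v} (prefix_clusters P v)
     else extend v (D \<inter> {1..<v}) (prefix_clusters P v))"
proof -
  have v: "v \<ge> 1" using P D by (auto simp: partition_on_def)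
  have D': "D \<inter> {1..<Suc v} = insert v (D \<inter> {1..<v})"
    using v D by auto
  have E': "E \<inter> {1..<Suc v} = E \<inter> {1..<v}" if "E \<in> P - {D}" for E
  proof -
    have "v \<notin> E" using partition_cluster_unique[OF P] D that by blast
    then show ?thesis by (auto simp: less_Suc_eq)
  qed
  \<comment> \<open>A nonempty trace determines its cluster, so deleting the old trace of
    \<open>D\<close> in \<open>extend\<close> deletes no other trace with it.\<close>
  have ne: "E \<inter> {1..<v} \<noteq> D \<inter> {1..<v}" if "E \<in> P - {D}" "D \<inter> {1..<v} \<noteq> {}" for E
    using partition_cluster_unique[OF P] D that by blast
  have P': "P = insert D (P - {D})" using D by auto
  have L: "(\<lambda>C. C \<inter> {1..<Suc v}) ` P =
      insert (insert v (D \<inter> {1..<v})) ((\<lambda>C. C \<inter> {1..<v}) ` (P - {D}))"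
  proof -
    have "(\<lambda>C. C \<inter> {1..<Suc v}) ` (P - {D}) = (\<lambda>C. C \<inter> {1..<v}) ` (P - {D})"
      by (rule image_cong[OF refl E'])
    then show ?thesis by (subst P', subst image_insert, subst D') (rule arg_cong)
  qed
  have R: "(\<lambda>C. C \<inter> {1..<v}) ` P = insert (D \<inter> {1..<v}) ((\<lambda>C. C \<inter> {1..<v}) ` (P - {D}))"
    using D by blast
  show ?thesis
    using ne unfolding prefix_clusters_def L R extend_def by auto
qed

text \<open>At most one trace can match, so the outcome of the search does not depend on the order
  of the comparisons; the order affects the cost alone.\<close>

lemma matching_prefix_clusters:
  assumes P: "partition_on {1..n} P" and D: "D \<in> P" "v \<in> D"
    and Cs: "set Cs = prefix_clusters P v"
  shows "matching P v Cs = (if D \<inter> {1..<v} = {} then None else Some (D \<inter> {1..<v}))"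
proof (cases "D \<inter> {1..<v} = {}")
  case True
  have "\<not> same_cluster P {Min C, v}" if "C \<in> set Cs" for C
    using same_cluster_Min_iff[OF P D, of C] that True Cs by (auto simp: prefix_clusters_def)
  then show ?thesis using True by (simp add: find_None_iff)
next
  case False
  then have "D \<inter> {1..<v} \<in> set Cs" using Cs D by (auto simp: prefix_clusters_def)
  then have "matching P v Cs \<noteq> None"
    using same_cluster_Min_iff[OF P D] Cs by (auto simp: find_None_iff)
  then obtain C where "matching P v Cs = Some C" by auto
  moreover from this have "C \<in> set Cs" "same_cluster P {Min C, v}"
    by (auto simp: find_Some_iff)
  ultimately show ?thesis
    using same_cluster_Min_iff[OF P D] Cs False by auto
qed

text \<open>The truth of \<open>skip\<close> is a hypothesis of \<open>correct_run\<close> rather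
  than an assumption here, because validity and the worst-case query bound must hold for every side
  information.\<close>

locale strategy =
  fixes skip :: "nat \<Rightarrow> nat set set \<Rightarrow> nat set option"
    and ord :: "nat \<Rightarrow> nat set set \<Rightarrow> nat set list"
    and abort :: "nat set \<Rightarrow> bool"
  assumes skip_in: "skip v Q = Some C \<Longrightarrow> C \<in> Q"
    and set_ord: "finite Q \<Longrightarrow> set (ord v Q) = Q"
    and distinct_ord: "finite Q \<Longrightarrow> distinct (ord v Q)"
begin

abbreviation "tree \<equiv> cluster_tree skip ord abort"

lemma length_ord: "finite Q \<Longrightarrow> length (ord v Q) = card Q"
  by (metis distinct_card distinct_ord set_ord)

text \<open>The invariant makes \<open>Min C\<close> a vertex smaller than \<open>v\<close>, even
  for a wrong clustering \<open>Q\<close>, and every update of \<open>Q\<close> preserves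
  it.\<close>

lemma queried_tree:
  assumes "finite Q" "\<And>C. C \<in> Q \<Longrightarrow> C \<noteq> {} \<and> C \<subseteq> {1..<v}" "v \<ge> 1"
  shows "queried (tree [v..<Suc n] Q) \<subseteq> pairs n"
  using assms
proof (induction "Suc n - v" arbitrary: v Q)
  case 0
  then show ?case by simp
next
  case (Suc d)
  then have vn: "v \<le> n" by simp
  then have upt: "[v..<Suc n] = v # [Suc v..<Suc n]" by (simp add: upt_rec)
  have new: "queried (tree [Suc v..<Suc n] (insert {v} Q)) \<subseteq> pairs n"
  proof (rule Suc.hyps(1))
    show "C \<noteq> {} \<and> C \<subseteq> {1..<Suc v}" if "C \<in> insert {v} Q" for C
      using that Suc.prems(2)[of C] Suc.prems(3) by force
  qed (use Suc in auto)
  have ext: "queried (tree [Suc v..<Suc n] (extend v C Q)) \<subseteq> pairs n" if C: "C \<in> Q" for C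
  proof (rule Suc.hyps(1))
    show "E \<noteq> {} \<and> E \<subseteq> {1..<Suc v}" if "E \<in> extend v C Q" for E
      using that Suc.prems(2)[of E] Suc.prems(2)[of C] C Suc.prems(3)
      by (force simp: extend_def)
  qed (use Suc in \<open>auto simp: extend_def\<close>)
  have pr: "{Min C, v} \<in> pairs n" if "C \<in> Q" for C
  proof -
    have C: "C \<noteq> {}" "C \<subseteq> {1..<v}" using Suc.prems(2)[OF that] by auto
    then have "Min C \<in> C" using finite_subset by (intro Min_in) auto
    then have "Min C \<in> {1..<v}" using C by blast
    then have "Min C \<in> {1..n}" "v \<in> {1..n}" "Min C \<noteq> v" using vn by auto
    then show ?thesis unfolding pairs_def by blast
  qed
  show ?case
  proof (cases "skip v Q")
    case None
    let ?f = "\<lambda>x. case x of None \<Rightarrow> tree [Suc v..<Suc n] (insert {v} Q)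
           | Some C \<Rightarrow> if abort C then Output {} else tree [Suc v..<Suc n] (extend v C Q)"
    have "queried (locate v (ord v Q) ?f) \<subseteq> pairs n"
    proof (rule order_trans[OF queried_locate], intro Un_least UN_least image_subsetI)
      show "queried (?f (Some C)) \<subseteq> pairs n" if "C \<in> set (ord v Q)" for C
        using ext[of C] that set_ord[OF Suc.prems(1)] by simp
    qed (use pr new set_ord[OF Suc.prems(1)] in auto)
    then show ?thesis using None by (simp add: upt del: upt_Suc)
  next
    case (Some C)
    then show ?thesis using ext[of C] skip_in[OF Some] by (simp add: upt del: upt_Suc)
  qed
qed

text \<open>By induction on the number of remaining vertices, the state before \<open>v\<close> is
  always \<open>prefix_clusters P v\<close>. The budget \<open>q u\<close> of a vertex is a
  parameter, stated for an arbitrary continuation \<open>f\<close>, so that crude and sharp counts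
  can both be inserted.\<close>

lemma correct_run:
  assumes P: "partition_on {1..n} P"
    and skip_ok: "\<And>u C. u \<in> {1..n} \<Longrightarrow> skip u (prefix_clusters P u) = Some C \<Longrightarrow>
                    same_cluster P {Min C, u}"
    and abort_ok: "\<And>u C. u \<in> {1..n} \<Longrightarrow> skip u (prefix_clusters P u) = None \<Longrightarrow>
                    C \<in> prefix_clusters P u \<Longrightarrow> same_cluster P {Min C, u} \<Longrightarrow> \<not> abort C"
    and cost: "\<And>u f. u \<in> {1..n} \<Longrightarrow>
       num_queries P (locate u (ord u (prefix_clusters P u)) f)
         \<le> q u + num_queries P (f (matching P u (ord u (prefix_clusters P u))))"
    and v: "1 \<le> v" "v \<le> Suc n"
  shows "result P (tree [v..<Suc n] (prefix_clusters P v)) = P \<and>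
         num_queries P (tree [v..<Suc n] (prefix_clusters P v)) \<le> (\<Sum>u=v..n. q u)"
  using v
proof (induction "Suc n - v" arbitrary: v)
  case 0
  then have "v = Suc n" by simp
  then show ?case using prefix_clusters_all[OF P] by simp
next
  case (Suc d)
  then have vn: "v \<le> n" and vr: "v \<in> {1..n}" by simp_all
  then have upt: "[v..<Suc n] = v # [Suc v..<Suc n]" by (simp add: upt_rec)
  let ?Q = "prefix_clusters P v"
  have fin: "finite ?Q" using finite_prefix_clusters finite_partition P by blast
  obtain D where D: "D \<in> P" "v \<in> D" using partition_onD1[OF P] vr by blast
  have IH: "result P (tree [Suc v..<Suc n] (prefix_clusters P (Suc v))) = P"
    "num_queries P (tree [Suc v..<Suc n] (prefix_clusters P (Suc v))) \<le> (\<Sum>u=Suc v..n. q u)"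
    using Suc.hyps(1)[of "Suc v"] Suc.hyps(2) vn by auto
  have sum: "(\<Sum>u=v..n. q u) = q v + (\<Sum>u=Suc v..n. q u)"
    using vn by (simp add: sum.atLeast_Suc_atMost)
  show ?case
  proof (cases "skip v ?Q")
    case (Some C)
    then have C: "C \<in> ?Q" by (rule skip_in)
    then have C': "C = D \<inter> {1..<v}" using same_cluster_Min_iff[OF P D C] skip_ok[OF vr Some] by simp
    moreover have "C \<noteq> {}" using C by (auto simp: prefix_clusters_def)
    ultimately have "prefix_clusters P (Suc v) = extend v C ?Q"
      using prefix_clusters_Suc[OF P D] by simp
    then show ?thesis using Some IH sum by (simp add: upt del: upt_Suc)
  next
    case None
    let ?f = "\<lambda>x. case x of None \<Rightarrow> tree [Suc v..<Suc n] (insert {v} ?Q)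
           | Some C \<Rightarrow> if abort C then Output {} else tree [Suc v..<Suc n] (extend v C ?Q)"
    have tr: "tree [v..<Suc n] ?Q = locate v (ord v ?Q) ?f"
      using None by (simp add: upt del: upt_Suc)
    have "?f (matching P v (ord v ?Q)) = tree [Suc v..<Suc n] (prefix_clusters P (Suc v))"
    proof (cases "D \<inter> {1..<v} = {}")
      case True
      then show ?thesis
        using matching_prefix_clusters[OF P D set_ord[OF fin]] prefix_clusters_Suc[OF P D] by simp
    next
      case False
      then have "D \<inter> {1..<v} \<in> ?Q" using D by (auto simp: prefix_clusters_def)
      then have "\<not> abort (D \<inter> {1..<v})"
        using abort_ok[OF vr None] same_cluster_Min_iff[OF P D] by blast
      then show ?thesis
        using matching_prefix_clusters[OF P D set_ord[OF fin]] prefix_clusters_Suc[OF P D] False by simp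
    qed
    then show ?thesis
      using cost[OF vr, of ?f] IH sum unfolding tr result_locate by (simp del: upt_Suc)
  qed
qed

end

section \<open>A query bound valid for every side information\<close>

lemma card_le_card_clusters:
  assumes P: "partition_on {1..n} P"
    and Q: "\<And>C. C \<in> Q \<Longrightarrow> g C \<in> {1..n}"
    and sep: "\<And>C C'. C \<in> Q \<Longrightarrow> C' \<in> Q \<Longrightarrow> C \<noteq> C' \<Longrightarrow> \<not> same_cluster P {g C, g C'}"
  shows "card Q \<le> card P"
proof -
  have "\<forall>C\<in>Q. \<exists>D\<in>P. g C \<in> D" using P Q by (auto simp: partition_on_def)
  then obtain h where h: "\<And>C. C \<in> Q \<Longrightarrow> h C \<in> P \<and> g C \<in> h C" by metis
  \<comment> \<open>Two representatives in the same true cluster would violate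
    \<open>sep\<close>.\<close>
  have "inj_on h Q"
  proof (rule inj_onI)
    fix C C' assume "C \<in> Q" "C' \<in> Q" "h C = h C'"
    then show "C = C'" using sep[of C C'] h[of C] h[of C'] by (auto simp: same_cluster_def)
  qed
  then show ?thesis using h finite_partition[OF P] by (intro card_inj_on_le) auto
qed

context strategy
begin

text \<open>The factor of \<open>card P\<close> on the right is a potential: it never increases, and it drops with every
  vertex that causes queries, except possibly for a last one that makes the run abort. The true
  clusters of the minima are distinct even when \<open>skip\<close> makes mistakes.\<close>

lemma num_queries_tree_le:
  assumes P: "partition_on {1..n} P" and m: "m \<ge> 1"
    and abort: "\<And>C. abort C \<longleftrightarrow> card C \<ge> m"
    and Q: "finite Q" "\<And>C. C \<in> Q \<Longrightarrow> C \<noteq> {} \<and> C \<subseteq> {1..<v}"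
    and sep: "\<And>C C'. C \<in> Q \<Longrightarrow> C' \<in> Q \<Longrightarrow> C \<noteq> C' \<Longrightarrow> \<not> same_cluster P {Min C, Min C'}"
    and v: "1 \<le> v" "v \<le> Suc n"
  shows "num_queries P (tree [v..<Suc n] Q)
           \<le> card P * ((card P - card Q) * m + (\<Sum>C\<in>Q. m - card C) + 1)"
  using Q sep v
proof (induction "Suc n - v" arbitrary: v Q)
  case 0
  then show ?case by simp
next
  case (Suc d)
  then have vn: "v \<le> n" by simp
  then have upt: "[v..<Suc n] = v # [Suc v..<Suc n]" by (simp add: upt_rec)
  \<comment> \<open>The potential: \<open>m\<close> for each cluster not yet found, and for each
    found one the number of members missing to size \<open>m\<close>, cut off at 0 by subtraction on
    \<open>nat\<close>.\<close>
  let ?\<Phi> = "\<lambda>Q. (card P - card Q) * m + (\<Sum>C\<in>Q. m - card C)"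
  have fin: "finite C" if "C \<in> Q" for C
    using Suc.prems(2)[OF that] finite_subset by auto
  have Mn: "Min C \<in> {1..<v}" if "C \<in> Q" for C
    using Min_in[OF fin[OF that]] Suc.prems(2)[OF that] by blast
  have cQ: "card Q \<le> card P"
    by (rule card_le_card_clusters[OF P, of Q Min]) (use Mn vn Suc.prems(3) in force)+
  have vQ: "v \<notin> C" if "C \<in> Q" for C using Suc.prems(2)[OF that] by auto
  have ext: "num_queries P (tree [Suc v..<Suc n] (extend v C Q))
      \<le> card P * (?\<Phi> (extend v C Q) + 1)" if C: "C \<in> Q" for C
  proof (rule Suc.hyps(1))
    show "E \<noteq> {} \<and> E \<subseteq> {1..<Suc v}" if "E \<in> extend v C Q" for E
      using that Suc.prems(2)[of E] Suc.prems(2)[of C] C Suc.prems(4)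
      by (force simp: extend_def)
    \<comment> \<open>\<open>v\<close> exceeds all of \<open>C\<close>, so the representatives, and
      with them their separation, survive the extension.\<close>
    have Mi: "Min (insert v C) = Min C"
      using Min_insert[OF fin[OF C], of v] Mn[OF C] Suc.prems(2)[OF C] by (simp del: Min_insert)
    show "\<not> same_cluster P {Min E, Min E'}"
      if EE: "E \<in> extend v C Q" "E' \<in> extend v C Q" "E \<noteq> E'" for E E'
    proof -
      have E: "\<exists>F'\<in>Q. Min F' = Min F \<and> (F = insert v C \<and> F' = C \<or> F \<in> Q - {C} \<and> F' = F)"
        if "F \<in> extend v C Q" for F
      proof (cases "F = insert v C")
        case True
        then show ?thesis using C Mi by (intro bexI[of _ C]) simp_all
      next
        case False
        then show ?thesis using that by (intro bexI[of _ F]) (simp_all add: extend_def)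
      qed
      obtain F F' where "F \<in> Q" "F' \<in> Q" "F \<noteq> F'" "Min F = Min E" "Min F' = Min E'"
        using E[OF EE(1)] E[OF EE(2)] EE(3) by auto
      then show ?thesis using Suc.prems(3)[of F F'] by simp
    qed
  qed (use Suc vn in \<open>auto simp: extend_def\<close>)
  have card_ext: "card (extend v C Q) = card Q" if C: "C \<in> Q" for C
    using C vQ Suc.prems(1) unfolding extend_def
    by (subst card_insert_disjoint) (auto simp: card_Suc_Diff1 simp del: card_Diff_insert card_Diff_singleton)
  have sum_ext: "(\<Sum>C\<in>extend v C Q. m - card C) = (m - Suc (card C)) + (\<Sum>C\<in>Q-{C}. m - card C)"
    if C: "C \<in> Q" for C
    using C vQ Suc.prems(1) fin[OF C] unfolding extend_def by (subst sum.insert) auto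
  have sum_Q: "(\<Sum>C\<in>Q. m - card C) = (m - card C) + (\<Sum>C\<in>Q-{C}. m - card C)"
    if C: "C \<in> Q" for C
    using C Suc.prems(1) by (simp add: sum.remove)
  have ext_le: "?\<Phi> (extend v C Q) \<le> ?\<Phi> Q" if C: "C \<in> Q" for C
    using card_ext[OF C] sum_ext[OF C] sum_Q[OF C] by simp
  \<comment> \<open>Below size \<open>m\<close> the cutoff is not active, so a new member lowers the
    potential by exactly one.\<close>
  have ext_less: "?\<Phi> (extend v C Q) + 1 \<le> ?\<Phi> Q" if C: "C \<in> Q" "card C < m" for C
    using card_ext[OF C(1)] sum_ext[OF C(1)] sum_Q[OF C(1)] C by simp
  show ?case
  proof (cases "skip v Q")
    case (Some C)
    then have C: "C \<in> Q" by (rule skip_in)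
    have "num_queries P (tree [v..<Suc n] Q) = num_queries P (tree [Suc v..<Suc n] (extend v C Q))"
      using Some by (simp add: upt del: upt_Suc)
    also have "\<dots> \<le> card P * (?\<Phi> (extend v C Q) + 1)" by (rule ext[OF C])
    also have "\<dots> \<le> card P * (?\<Phi> Q + 1)" by (intro mult_left_mono add_right_mono ext_le C) simp
    finally show ?thesis .
  next
    case None
    let ?f = "\<lambda>x. case x of None \<Rightarrow> tree [Suc v..<Suc n] (insert {v} Q)
           | Some C \<Rightarrow> if abort C then Output {} else tree [Suc v..<Suc n] (extend v C Q)"
    let ?x = "matching P v (ord v Q)"
    have tr: "tree [v..<Suc n] Q = locate v (ord v Q) ?f"
      using None by (simp add: upt del: upt_Suc)
    \<comment> \<open>Comparing \<open>v\<close> costs up to \<open>card P\<close>, which is the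
      summand \<open>+ 1\<close> of the bound. The rest of the run must pay for itself by a drop of
      the potential, or stop by \<open>abort\<close>.\<close>
    have "num_queries P (?f ?x) \<le> card P * ?\<Phi> Q"
    proof (cases ?x)
      case N: None
      then have nm: "\<not> same_cluster P {Min C, v}" if "C \<in> Q" for C
        using that set_ord[OF Suc.prems(1)] by (auto simp: find_None_iff)
      have sep': "\<not> same_cluster P {Min E, Min E'}"
        if "E \<in> insert {v} Q" "E' \<in> insert {v} Q" "E \<noteq> E'" for E E'
        using that nm Suc.prems(3) by (auto simp: insert_commute)
      have "num_queries P (?f ?x) = num_queries P (tree [Suc v..<Suc n] (insert {v} Q))"
        using N by simp
      also have "\<dots> \<le> card P * (?\<Phi> (insert {v} Q) + 1)"
      proof (rule Suc.hyps(1))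
        show "E \<noteq> {} \<and> E \<subseteq> {1..<Suc v}" if "E \<in> insert {v} Q" for E
          using that Suc.prems(2)[of E] Suc.prems(4) by force
      qed (use Suc vn sep' in auto)
      also have "\<dots> \<le> card P * ?\<Phi> Q"
      proof (rule mult_left_mono)
        have nin: "{v} \<notin> Q" using vQ by blast
        have "card (insert {v} Q) \<le> card P"
        proof (rule card_le_card_clusters[OF P, of _ Min])
          show "Min C \<in> {1..n}" if "C \<in> insert {v} Q" for C
            using that Mn[of C] vn Suc.prems(4) by auto
        qed (rule sep')
        \<comment> \<open>A new cluster turns a summand \<open>m\<close> into \<open>m - 1\<close>.
          The bound on \<open>card (insert {v} Q)\<close> ensures that the subtraction from
          \<open>card P\<close> is a genuine one.\<close>
        then have "card P - card Q = Suc (card P - card (insert {v} Q))"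
          using nin Suc.prems(1) by simp
        moreover have "(\<Sum>C\<in>insert {v} Q. m - card C) = (m - 1) + (\<Sum>C\<in>Q. m - card C)"
          using nin Suc.prems(1) by simp
        ultimately show "?\<Phi> (insert {v} Q) + 1 \<le> ?\<Phi> Q" using m by simp
      qed simp
      finally show ?thesis .
    next
      case (Some C)
      then have C: "C \<in> Q" using set_ord[OF Suc.prems(1)]
        by (metis find_Some_iff nth_mem)
      show ?thesis
      proof (cases "card C < m")
        case True
        then have "num_queries P (?f ?x) = num_queries P (tree [Suc v..<Suc n] (extend v C Q))"
          using Some abort by simp
        also have "\<dots> \<le> card P * (?\<Phi> (extend v C Q) + 1)" by (rule ext[OF C])
        also have "\<dots> \<le> card P * ?\<Phi> Q" by (intro mult_left_mono ext_less C True) simp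
        finally show ?thesis .
      qed (use Some abort in simp)
    qed
    moreover have "num_queries P (tree [v..<Suc n] Q) \<le> length (ord v Q) + num_queries P (?f ?x)"
      unfolding tr by (rule num_queries_locate_le)
    moreover have "length (ord v Q) \<le> card P" using cQ length_ord[OF Suc.prems(1)] by simp
    ultimately show ?thesis by (simp add: algebra_simps)
  qed
qed

lemma num_queries_tree_start_le:
  assumes "partition_on {1..n} P" "m \<ge> 1" "\<And>C. abort C \<longleftrightarrow> card C \<ge> m"
  shows "num_queries P (tree [1..<Suc n] {}) \<le> card P * (card P * m + 1)"
  using num_queries_tree_le[OF assms, of "{}" 1] by simp

end

section \<open>Concentration of the side information\<close>

lemma unit_distribution_component:
  assumes "unit_distribution Dp" "unit_distribution Dm"
  shows "prob_space (if b then Dp else Dm)" "sets (if b then Dp else Dm) = sets borel"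
    "AE x in (if b then Dp else Dm). x \<in> {0..1}"
  using assms by (auto simp: unit_distribution_def)

lemma prob_space_side_info:
  assumes "unit_distribution Dp" "unit_distribution Dm"
  shows "prob_space (side_info_measure n P Dp Dm)"
  unfolding side_info_measure_def
  by (intro prob_space_PiM unit_distribution_component assms)

lemma sets_side_info:
  assumes "unit_distribution Dp" "unit_distribution Dm"
  shows "sets (side_info_measure n P Dp Dm) = sets (\<Pi>\<^sub>M e\<in>pairs n. borel)"
  unfolding side_info_measure_def
  by (intro sets_PiM_cong refl unit_distribution_component assms)

lemma distr_side_info_component:
  assumes D: "unit_distribution Dp" "unit_distribution Dm" and e: "e \<in> pairs n"
  shows "distr (side_info_measure n P Dp Dm) borel (\<lambda>W. W e) = (if same_cluster P e then Dp else Dm)"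
proof -
  have "distr (side_info_measure n P Dp Dm) borel (\<lambda>W. W e) =
      distr (side_info_measure n P Dp Dm) (if same_cluster P e then Dp else Dm) (\<lambda>W. W e)"
    by (intro distr_cong refl) (simp only: unit_distribution_component(2)[OF D])
  also have "\<dots> = (if same_cluster P e then Dp else Dm)"
    unfolding side_info_measure_def
    by (rule distr_PiM_component) (use e unit_distribution_component(1)[OF D] in auto)
  finally show ?thesis .
qed

lemma measurable_side_info_component:
  assumes "e \<in> pairs n"
  shows "(\<lambda>W. W e) \<in> (\<Pi>\<^sub>M e\<in>pairs n. borel) \<rightarrow>\<^sub>M borel"
  using assms by (rule measurable_component_singleton)

text \<open>Independence means that the joint law is the product of the marginals. The joint map is
  the identity on the product space, and the marginals are its factors.\<close>

lemma indep_side_info: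
  assumes D: "unit_distribution Dp" "unit_distribution Dm" and I: "I \<subseteq> pairs n" "I \<noteq> {}"
  shows "prob_space.indep_vars (side_info_measure n P Dp Dm) (\<lambda>_. borel) (\<lambda>e W. W e) I"
proof -
  let ?M = "side_info_measure n P Dp Dm"
  interpret prob_space ?M by (rule prob_space_side_info[OF D])
  have meas: "(\<lambda>W. W e) \<in> ?M \<rightarrow>\<^sub>M borel" if "e \<in> pairs n" for e
    using measurable_side_info_component[OF that] measurable_cong_sets[OF sets_side_info[OF D] refl]
    by blast
  have "indep_vars (\<lambda>_. borel) (\<lambda>e W. W e) (pairs n)"
  proof (subst indep_vars_iff_distr_eq_PiM')
    have "distr ?M (\<Pi>\<^sub>M e\<in>pairs n. borel) (\<lambda>W. \<lambda>e\<in>pairs n. W e) = distr ?M ?M (\<lambda>W. W)"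
    proof (rule distr_cong)
      show "sets (\<Pi>\<^sub>M e\<in>pairs n. borel) = sets ?M" using sets_side_info[OF D] by simp
      show "(\<lambda>e\<in>pairs n. W e) = W" if "W \<in> space ?M" for W
        using that by (auto simp: side_info_measure_def space_PiM PiE_def extensional_restrict)
    qed simp
    also have "\<dots> = ?M" by (rule distr_id)
    also have "\<dots> = (\<Pi>\<^sub>M e\<in>pairs n. distr ?M borel (\<lambda>W. W e))"
      unfolding side_info_measure_def[of n P Dp Dm]
      using distr_side_info_component[OF D] 
      by (intro PiM_cong refl) (simp add: side_info_measure_def)
    finally show "distr ?M (\<Pi>\<^sub>M e\<in>pairs n. borel) (\<lambda>W. \<lambda>e\<in>pairs n. W e) =
      (\<Pi>\<^sub>M e\<in>pairs n. distr ?M borel (\<lambda>W. W e))" .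
  qed (use I meas in auto)
  then show ?thesis using I(1) by (rule indep_vars_subset)
qed

text \<open>The pairs \<open>{u, v}\<close> with \<open>u\<close> in the fixed set \<open>S\<close>
  are distinct, so their weights are independent; by \<open>same\<close> they have a common mean.
  This is Hoeffding's inequality for \<open>card S\<close> variables with values in [0,1].\<close>

lemma side_info_concentration:
  assumes D: "unit_distribution Dp" "unit_distribution Dm"
    and S: "S \<subseteq> {1..n}" "v \<in> {1..n}" "v \<notin> S" "S \<noteq> {}"
    and same: "\<And>u. u \<in> S \<Longrightarrow> same_cluster P {u, v} \<longleftrightarrow> b"
    and \<epsilon>: "\<epsilon> \<ge> 0"
  shows "measure (side_info_measure n P Dp Dm)
     {W \<in> space (side_info_measure n P Dp Dm).
        \<bar>(\<Sum>u\<in>S. W {u, v}) - real (card S) * mean (if b then Dp else Dm)\<bar> \<ge> real (card S) * \<epsilon>}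
     \<le> 2 * exp (- 2 * real (card S) * \<epsilon>\<^sup>2)"
proof -
  let ?M = "side_info_measure n P Dp Dm" and ?D = "if b then Dp else Dm"
  let ?I = "(\<lambda>u. {u, v}) ` S"
  have finS: "finite S" using S(1) finite_subset by blast
  have I: "?I \<subseteq> pairs n" using S unfolding pairs_def by blast
  have inj: "inj_on (\<lambda>u. {u, v}) S" by (auto simp: inj_on_def doubleton_eq_iff)
  interpret prob_space ?M by (rule prob_space_side_info[OF D])
  have meas: "(\<lambda>W. W e) \<in> ?M \<rightarrow>\<^sub>M borel" if "e \<in> pairs n" for e
    using measurable_side_info_component[OF that] measurable_cong_sets[OF sets_side_info[OF D] refl]
    by blast
  have E: "expectation (\<lambda>W. W e) = mean ?D" if "e \<in> ?I" for e
  proof -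
    have "mean ?D = (\<integral>x. x \<partial>distr ?M borel (\<lambda>W. W e))"
    proof -
      have "e \<in> pairs n" using that I by blast
      moreover have "same_cluster P e = b" using that same by auto
      ultimately show ?thesis using distr_side_info_component[OF D, of e n P] by (simp add: mean_def)
    qed
    also have "\<dots> = expectation (\<lambda>W. W e)"
      using that I by (intro integral_distr meas) auto
    finally show ?thesis ..
  qed
  interpret H: Hoeffding_ineq ?M ?I "\<lambda>e W. W e" "\<lambda>_. 0" "\<lambda>_. 1" "\<Sum>e\<in>?I. expectation (\<lambda>W. W e)"
  proof unfold_locales
    show "AE W in ?M. W e \<in> {0..1}" if "e \<in> ?I" for e
      unfolding side_info_measure_def
      by (rule AE_PiM_component) (use that I unit_distribution_component[OF D] in auto)
  qed (use finS indep_side_info[OF D I] S(4) in auto)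
  have card: "card ?I = card S" using inj by (rule card_image)
  have cpos: "card S > 0" using finS S(4) by (simp add: card_gt_0_iff)
  have "prob {W \<in> space ?M. \<bar>(\<Sum>e\<in>?I. W e) - (\<Sum>e\<in>?I. expectation (\<lambda>W. W e))\<bar> \<ge> real (card S) * \<epsilon>}
      \<le> 2 * exp (-2 * (real (card S) * \<epsilon>)\<^sup>2 / (\<Sum>e\<in>?I. (1 - 0)\<^sup>2))"
    by (rule H.Hoeffding_ineq_abs_ge) (use \<epsilon> cpos card in auto)
  also have "(\<Sum>e\<in>?I. expectation (\<lambda>W. W e)) = real (card S) * mean ?D"
    using E by (subst sum.cong[OF refl E]) (auto simp: card)
  also have "(\<Sum>e\<in>?I. (1 - 0)\<^sup>2) = real (card S)" using card by simp
  also have "- 2 * (real (card S) * \<epsilon>)\<^sup>2 / real (card S) = - 2 * real (card S) * \<epsilon>\<^sup>2"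
    using cpos by (simp add: power2_eq_square)
  also have "(\<lambda>W. \<Sum>e\<in>?I. W e) = (\<lambda>W. \<Sum>u\<in>S. W {u, v})"
    using inj by (simp add: sum.reindex)
  finally show ?thesis .
qed

section \<open>The bad event and its probability\<close>

definition deviates :: "nat set set \<Rightarrow> real measure \<Rightarrow> real measure \<Rightarrow> (nat \<Rightarrow> real) \<Rightarrow>
    nat \<Rightarrow> nat set \<Rightarrow> side_info \<Rightarrow> bool" where
  "deviates P Dp Dm \<epsilon> v C W \<longleftrightarrow>
     \<bar>(\<Sum>u\<in>C. W {u, v}) - real (card C) * mean (if same_cluster P {Min C, v} then Dp else Dm)\<bar>
       \<ge> real (card C) * \<epsilon> (card C)"

text \<open>Only traces of true clusters are quantified, not the clusters of an actual run, which
  would depend on \<open>W\<close>. The radius \<epsilon> is a function of the size: the Monte Carlo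
  analysis takes it constant, the Las Vegas analysis of order
  \<open>sqrt (ln n / s)\<close>.\<close>

definition bad_event :: "nat \<Rightarrow> nat set set \<Rightarrow> real measure \<Rightarrow> real measure \<Rightarrow> (nat \<Rightarrow> real) \<Rightarrow> nat \<Rightarrow>
    side_info set" where
  "bad_event n P Dp Dm \<epsilon> m = {W \<in> space (side_info_measure n P Dp Dm).
     \<exists>v\<in>{1..n}. \<exists>C\<in>prefix_clusters P v. card C \<ge> m \<and> deviates P Dp Dm \<epsilon> v C W}"

lemma prefix_clusters_subset: "C \<in> prefix_clusters P v \<Longrightarrow> C \<noteq> {} \<and> C \<subseteq> {1..<v}"
  by (auto simp: prefix_clusters_def)

text \<open>Justifies the use of \<open>Min C\<close> in \<open>deviates\<close>: all weights summed
  there have the same law.\<close>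

lemma same_cluster_prefix_member:
  assumes P: "partition_on {1..n} P" and C: "C \<in> prefix_clusters P v" and u: "u \<in> C" "u' \<in> C"
  shows "same_cluster P {u, v} \<longleftrightarrow> same_cluster P {u', v}"
proof -
  obtain E where E: "E \<in> P" "C \<subseteq> E" using C by (auto simp: prefix_clusters_def)
  have "same_cluster P {w, v} \<longleftrightarrow> v \<in> E" if "w \<in> C" for w
    using E that partition_cluster_unique[OF P _ E(1), of _ w]
    by (auto simp: same_cluster_def)
  then show ?thesis using u by simp
qed

lemma deviates_measurable:
  assumes D: "unit_distribution Dp" "unit_distribution Dm" 
    and "v \<in> {1..n}" "C \<in> prefix_clusters P v"
  shows "{W \<in> space (side_info_measure n P Dp Dm). deviates P Dp Dm \<epsilon> v C W}
    \<in> sets (side_info_measure n P Dp Dm)"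
proof -
  have [measurable]: "(\<lambda>W. W {u, v}) \<in> borel_measurable (side_info_measure n P Dp Dm)" if "u \<in> C" for u
  proof -
    have "{u, v} \<in> pairs n"
      using prefix_clusters_subset[OF assms(4)] that assms(3) unfolding pairs_def by force
    then show ?thesis
      using measurable_side_info_component measurable_cong_sets[OF sets_side_info[OF D] refl] by blast
  qed
  show ?thesis unfolding deviates_def by measurable
qed

text \<open>A union bound over \<open>n\<close> vertices and at most \<open>card P\<close> traces
  for each. Traces are nonempty, so the tail bound is asked for sizes \<open>s \<ge> 1\<close> only,
  which matters for \<open>m = 0\<close>.\<close>

lemma bad_event_prob:
  assumes D: "unit_distribution Dp" "unit_distribution Dm" and P: "partition_on {1..n} P"
    and \<epsilon>: "\<And>s. \<epsilon> s \<ge> 0"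
    and \<delta>: "\<And>s. s \<ge> 1 \<Longrightarrow> s \<ge> m \<Longrightarrow> 2 * exp (- 2 * real s * (\<epsilon> s)\<^sup>2) \<le> \<delta>" "\<delta> \<ge> 0"
  shows "bad_event n P Dp Dm \<epsilon> m \<in> sets (side_info_measure n P Dp Dm)"
    and "measure (side_info_measure n P Dp Dm) (bad_event n P Dp Dm \<epsilon> m) \<le> real n * real (card P) * \<delta>"
proof -
  let ?M = "side_info_measure n P Dp Dm"
  interpret prob_space ?M by (rule prob_space_side_info[OF D])
  let ?Q = "\<lambda>v. {C \<in> prefix_clusters P v. card C \<ge> m}"
  let ?B = "\<lambda>v C. {W \<in> space ?M. deviates P Dp Dm \<epsilon> v C W}"
  have fP: "finite P" using finite_partition[OF P] .
  have fQ: "finite (?Q v)" for v using finite_prefix_clusters[OF fP] by simp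
  have eq: "bad_event n P Dp Dm \<epsilon> m = (\<Union>v\<in>{1..n}. \<Union>C\<in>?Q v. ?B v C)"
    by (auto simp: bad_event_def)
  have B: "?B v C \<in> sets ?M" if "v \<in> {1..n}" "C \<in> ?Q v" for v C
    using that by (intro deviates_measurable D) auto
  show "bad_event n P Dp Dm \<epsilon> m \<in> sets ?M"
    unfolding eq by (intro sets.finite_UN finite_atLeastAtMost fQ B)
  have pB: "prob (?B v C) \<le> \<delta>" if v: "v \<in> {1..n}" and C: "C \<in> ?Q v" for v C
  proof -
    have C': "C \<noteq> {}" "C \<subseteq> {1..<v}" using prefix_clusters_subset C by auto
    then have fC: "finite C" using finite_subset by blast
    have "prob (?B v C) \<le> 2 * exp (- 2 * real (card C) * (\<epsilon> (card C))\<^sup>2)"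
      unfolding deviates_def
    proof (rule side_info_concentration[OF D])
      show "same_cluster P {u, v} \<longleftrightarrow> same_cluster P {Min C, v}" if "u \<in> C" for u
        using same_cluster_prefix_member[OF P _ that Min_in[OF fC C'(1)]] C by simp
    qed (use C' v \<epsilon> in auto)
    also have "\<dots> \<le> \<delta>" using C C' fC by (intro \<delta>) (auto simp: Suc_le_eq card_gt_0_iff)
    finally show ?thesis .
  qed
  have "prob (bad_event n P Dp Dm \<epsilon> m) \<le> (\<Sum>v\<in>{1..n}. prob (\<Union>C\<in>?Q v. ?B v C))"
    unfolding eq by (rule finite_measure_subadditive_finite) (use B fQ in \<open>auto intro!: sets.finite_UN\<close>)
  also have "\<dots> \<le> (\<Sum>v\<in>{1..n}. real (card P) * \<delta>)"
  proof (rule sum_mono)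
    fix v assume v: "v \<in> {1..n}"
    have "prob (\<Union>C\<in>?Q v. ?B v C) \<le> (\<Sum>C\<in>?Q v. prob (?B v C))"
      by (rule finite_measure_subadditive_finite) (use B[OF v] fQ in auto)
    also have "\<dots> \<le> (\<Sum>C\<in>?Q v. \<delta>)" by (intro sum_mono pB v)
    also have "\<dots> = real (card (?Q v)) * \<delta>" by simp
    also have "\<dots> \<le> real (card P) * \<delta>"
    proof (intro mult_right_mono \<delta>)
      have "card (?Q v) \<le> card (prefix_clusters P v)"
        by (rule card_mono[OF finite_prefix_clusters[OF fP]]) auto
      then show "real (card (?Q v)) \<le> real (card P)" using card_prefix_clusters_le[OF fP, of v] by simp
    qed
    finally show "prob (\<Union>C\<in>?Q v. ?B v C) \<le> real (card P) * \<delta>" .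
  qed
  also have "\<dots> = real n * real (card P) * \<delta>" by simp
  finally show "prob (bad_event n P Dp Dm \<epsilon> m) \<le> real n * real (card P) * \<delta>" .
qed

section \<open>Measurability and counting\<close>

definition list_clusters :: "nat set set \<Rightarrow> nat set list" where
  "list_clusters Q = (SOME xs. set xs = Q \<and> distinct xs)"

lemma list_clusters: "finite Q \<Longrightarrow> set (list_clusters Q) = Q \<and> distinct (list_clusters Q)"
  unfolding list_clusters_def using finite_distinct_list[of Q] by (rule someI_ex)

text \<open>The set of passed tests has finitely many possible values, and each fibre is a finite
  intersection of tests and complements. After a discrete space any \<open>g\<close> is
  measurable.\<close>

lemma measurable_finite_tests:
  assumes F: "finite F" and T: "\<And>x. x \<in> F \<Longrightarrow> {\<omega> \<in> space M. T \<omega> x} \<in> sets M"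
  shows "(\<lambda>\<omega>. g {x \<in> F. T \<omega> x}) \<in> M \<rightarrow>\<^sub>M count_space UNIV"
proof -
  have "(\<lambda>\<omega>. {x \<in> F. T \<omega> x}) \<in> M \<rightarrow>\<^sub>M count_space (Pow F)"
  proof (subst measurable_count_space_eq2, safe)
    fix X assume X: "X \<subseteq> F"
    have "(\<lambda>\<omega>. {x \<in> F. T \<omega> x}) -` {X} \<inter> space M = {\<omega> \<in> space M. \<forall>x\<in>F. T \<omega> x \<longleftrightarrow> x \<in> X}"
      using X by auto
    also have "\<dots> \<in> sets M"
    proof (rule sets.sets_Collect_finite_All[OF _ F])
      fix x assume "x \<in> F"
      then have "{\<omega> \<in> space M. T \<omega> x} \<in> sets M" "{\<omega> \<in> space M. \<not> T \<omega> x} \<in> sets M"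
        using T by (auto intro: sets.sets_Collect_neg)
      then show "{\<omega> \<in> space M. T \<omega> x \<longleftrightarrow> x \<in> X} \<in> sets M" by (cases "x \<in> X") auto
    qed
    finally show "(\<lambda>\<omega>. {x \<in> F. T \<omega> x}) -` {X} \<inter> space M \<in> sets M" .
  qed (use F in auto)
  then show ?thesis by (rule measurable_compose) simp
qed

text \<open>Since \<open>qtree\<close> is uncountable, measurability of an algorithm is obtained by letting the tree
  depend on the side information only through the outcomes of finitely many tests.\<close>

lemma valid_algorithm_tests:
  assumes F: "finite F"
    and T: "\<And>x. x \<in> F \<Longrightarrow>
      {W \<in> space (\<Pi>\<^sub>M e\<in>pairs n. borel). T W x} \<in> sets (\<Pi>\<^sub>M e\<in>pairs n. borel)"
    and g: "\<And>X. queried (g X) \<subseteq> pairs n"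
  shows "valid_algorithm n (\<lambda>W r. g {x \<in> F. T W x})"
proof -
  have "(\<lambda>W. g {x \<in> F. T W x}) \<in> (\<Pi>\<^sub>M e\<in>pairs n. borel) \<rightarrow>\<^sub>M count_space UNIV"
    by (rule measurable_finite_tests[OF F T])
  from measurable_compose[OF measurable_fst this] show ?thesis
    using g by (simp add: valid_algorithm_def case_prod_unfold)
qed

lemma measurable_sum_side_info:
  assumes "C \<subseteq> {1..n}" "v \<in> {1..n} - C"
  shows "(\<lambda>W::side_info. \<Sum>u\<in>C. W {u, v}) \<in> borel_measurable (\<Pi>\<^sub>M e\<in>pairs n. borel)"
proof (rule borel_measurable_sum)
  fix u assume "u \<in> C"
  then have "{u, v} \<in> pairs n" using assms unfolding pairs_def by blast
  then show "(\<lambda>W::side_info. W {u, v}) \<in> borel_measurable (\<Pi>\<^sub>M e\<in>pairs n. borel)"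
    by (rule measurable_side_info_component)
qed

lemma mean_unit_distribution:
  assumes "unit_distribution D"
  shows "0 \<le> mean D" "mean D \<le> 1"
proof -
  interpret prob_space D using assms by (simp add: unit_distribution_def)
  have AE: "AE x in D. x \<in> {0..1}" and [measurable_cong]: "sets D = sets borel"
    using assms by (auto simp: unit_distribution_def)
  have int: "integrable D (\<lambda>x. x)"
    by (rule integrable_const_bound[of _ 1]) (use AE in auto)
  show "0 \<le> mean D" unfolding mean_def
    by (rule integral_nonneg_AE) (use AE in auto)
  show "mean D \<le> 1" unfolding mean_def
    by (rule integral_le_const[OF int]) (use AE in auto)
qed

section \<open>Counting clusters and early vertices\<close>

lemma card_partition_le:
  assumes "partition_on {1..n::nat} P"
  shows "card P \<le> n"
proof -
  have "\<forall>C\<in>P. \<exists>x. x \<in> C" using partition_onD3[OF assms] by (metis ex_in_conv)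
  then obtain h where h: "\<And>C. C \<in> P \<Longrightarrow> h C \<in> C" by metis
  have "inj_on h P" using h partition_cluster_unique[OF assms] by (metis inj_onI)
  moreover have "h ` P \<subseteq> {1..n}" using h partition_onD1[OF assms] by blast
  ultimately have "card P \<le> card {1..n}" by (intro card_inj_on_le) auto
  then show ?thesis by simp
qed

text \<open>The number of earlier members is the rank of a vertex in its cluster, and it strictly
  increases along the cluster.\<close>

lemma card_prefix_cluster_inj:
  assumes "D \<subseteq> {1..n::nat}"
  shows "inj_on (\<lambda>v. card (D \<inter> {1..<v})) D"
proof (rule linorder_inj_onI)
  fix u v assume uv: "u < v" "u \<in> D" "v \<in> D"
  then have "D \<inter> {1..<u} \<subset> D \<inter> {1..<v}" using assms by force
  then show "card (D \<inter> {1..<u}) \<noteq> card (D \<inter> {1..<v})"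
    by (metis finite_Int finite_atLeastLessThan psubset_card_mono less_irrefl)
qed auto

text \<open>Each cluster has at most \<open>m\<close> vertices of rank below \<open>m\<close>. These
  are the vertices for which concentration is not yet available.\<close>

lemma card_early_vertices_le:
  assumes P: "partition_on {1..n::nat} P"
  shows "card {v. \<exists>D\<in>P. v \<in> D \<and> card (D \<inter> {1..<v}) < m} \<le> card P * m"
proof -
  have eq: "{v. \<exists>D\<in>P. v \<in> D \<and> card (D \<inter> {1..<v}) < m} =
      (\<Union>D\<in>P. {v \<in> D. card (D \<inter> {1..<v}) < m})" by auto
  have "card \<dots> \<le> (\<Sum>D\<in>P. card {v \<in> D. card (D \<inter> {1..<v}) < m})"
    by (rule card_UN_le[OF finite_partition[OF P]])
  also have "\<dots> \<le> (\<Sum>D\<in>P. m)"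
  proof (rule sum_mono)
    fix D assume "D \<in> P"
    then have D: "D \<subseteq> {1..n}" using partition_onD1[OF P] by blast
    have "card {v \<in> D. card (D \<inter> {1..<v}) < m} \<le> card {..<m}"
      by (rule card_inj_on_le[OF inj_on_subset[OF card_prefix_cluster_inj[OF D]]]) auto
    then show "card {v \<in> D. card (D \<inter> {1..<v}) < m} \<le> m" by simp
  qed
  finally show ?thesis unfolding eq by simp
qed

section \<open>The joint law of side information and internal randomness\<close>

lemma prob_space_uniform_unit: "prob_space (uniform_measure lborel {0..1::real})"
  by (intro prob_space_uniform_measure) auto

lemma sets_run_measure:
  assumes "unit_distribution Dp" "unit_distribution Dm"
  shows "sets (run_measure n P Dp Dm) = sets ((\<Pi>\<^sub>M e\<in>pairs n. borel) \<Otimes>\<^sub>M borel)"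
  unfolding run_measure_def
  by (intro sets_pair_measure_cong sets_side_info assms) simp

text \<open>Both algorithms are functions of \<open>W\<close> alone, so the events that matter are
  cylinders over events of the side information.\<close>

lemma emeasure_run_fst:
  assumes D: "unit_distribution Dp" "unit_distribution Dm"
    and A: "A \<in> sets (side_info_measure n P Dp Dm)"
  shows "A \<times> UNIV \<in> sets (run_measure n P Dp Dm)"
    and "emeasure (run_measure n P Dp Dm) (A \<times> UNIV) = emeasure (side_info_measure n P Dp Dm) A"
proof -
  interpret U: prob_space "uniform_measure lborel {0..1::real}" by (rule prob_space_uniform_unit)
  have U: "UNIV \<in> sets (uniform_measure lborel {0..1::real})" by simp
  show "A \<times> UNIV \<in> sets (run_measure n P Dp Dm)"
    unfolding run_measure_def using A U by (rule pair_measureI)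
  show "emeasure (run_measure n P Dp Dm) (A \<times> UNIV) = emeasure (side_info_measure n P Dp Dm) A"
    unfolding run_measure_def using U.emeasure_space_1
    by (subst U.emeasure_pair_measure_Times[OF A U]) (simp add: space_uniform_measure)
qed

section \<open>The Monte Carlo algorithm\<close>

text \<open>From this size on, Hoeffding's bound at radius \<open>\<Delta> / 2\<close> is at most
  \<open>2 * n powr (- (c + 3))\<close>. The 3 pays for the factor 2, the \<open>n\<close> vertices
  and the at most \<open>n\<close> traces.\<close>

definition mc_threshold :: "real \<Rightarrow> nat \<Rightarrow> real \<Rightarrow> nat" where
  "mc_threshold c n \<Delta> = nat \<lceil>2 * (c + 3) * ln (real n) / \<Delta>\<^sup>2\<rceil>"

text \<open>\<open>T\<close> stands for the outcomes of the tests. Misleading side information may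
  let several large clusters pass, hence the choice by \<open>SOME\<close>.\<close>

definition mc_skip :: "(nat set \<times> nat) set \<Rightarrow> nat \<Rightarrow> nat \<Rightarrow> nat set set \<Rightarrow> nat set option" where
  "mc_skip T m v Q =
     (if \<exists>C\<in>Q. card C \<ge> m \<and> (C, v) \<in> T
      then Some (SOME C. C \<in> Q \<and> card C \<ge> m \<and> (C, v) \<in> T) else None)"

definition mc_tree :: "nat \<Rightarrow> nat \<Rightarrow> (nat set \<times> nat) set \<Rightarrow> qtree" where
  "mc_tree n m T = cluster_tree (mc_skip T m) (\<lambda>_. list_clusters) (\<lambda>C. card C \<ge> m) [1..<Suc n] {}"

text \<open>All vertex sets are tested because the true clusters are unknown; the family is still
  finite, as measurability requires.\<close>

definition mc_tests :: "nat \<Rightarrow> real \<Rightarrow> side_info \<Rightarrow> (nat set \<times> nat) set" where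
  "mc_tests n \<theta> W = {x \<in> (SIGMA C:Pow {1..n}. {1..n} - C).
     (\<Sum>u\<in>fst x. W {u, snd x}) > real (card (fst x)) * \<theta>}"

definition mc_algorithm :: "real \<Rightarrow> nat \<Rightarrow> real \<Rightarrow> real \<Rightarrow> algorithm" where
  "mc_algorithm c n \<mu>p \<mu>m W r =
     mc_tree n (mc_threshold c n (\<mu>p - \<mu>m)) (mc_tests n ((\<mu>p + \<mu>m) / 2) W)"

lemma mc_skip_Some:
  assumes "mc_skip T m v Q = Some C"
  shows "C \<in> Q" "card C \<ge> m" "(C, v) \<in> T"
proof -
  have ex: "\<exists>C. C \<in> Q \<and> card C \<ge> m \<and> (C, v) \<in> T"
    and C: "C = (SOME C. C \<in> Q \<and> card C \<ge> m \<and> (C, v) \<in> T)"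
    using assms unfolding mc_skip_def by (auto split: if_splits)
  show "C \<in> Q" "card C \<ge> m" "(C, v) \<in> T" using someI_ex[OF ex] unfolding C by blast+
qed

lemma strategy_mc: "strategy (mc_skip T m) (\<lambda>_. list_clusters)"
  by unfold_locales (use mc_skip_Some list_clusters in auto)

lemma valid_mc_algorithm: "valid_algorithm n (mc_algorithm c n \<mu>p \<mu>m)"
proof -
  define m where "m = mc_threshold c n (\<mu>p - \<mu>m)"
  define \<theta> where "\<theta> = (\<mu>p + \<mu>m) / 2"
  have "valid_algorithm n (\<lambda>W r. mc_tree n m (mc_tests n \<theta> W))"
    unfolding mc_tests_def
  proof (rule valid_algorithm_tests)
    fix x assume "x \<in> (SIGMA C:Pow {1..n}. {1..n} - C)"
    then have [measurable]: "(\<lambda>W::side_info. \<Sum>u\<in>fst x. W {u, snd x}) \<in> borel_measurable (\<Pi>\<^sub>M e\<in>pairs n. borel)"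
      by (intro measurable_sum_side_info) auto
    show "{W \<in> space (\<Pi>\<^sub>M e\<in>pairs n. borel). (\<Sum>u\<in>fst x. W {u, snd x}) > real (card (fst x)) * \<theta>}
        \<in> sets (\<Pi>\<^sub>M e\<in>pairs n. borel)" by measurable
  next
    show "queried (mc_tree n m X) \<subseteq> pairs n" for X
      unfolding mc_tree_def by (rule strategy.queried_tree[OF strategy_mc]) auto
  qed auto
  then show ?thesis by (simp add: m_def \<theta>_def mc_algorithm_def[abs_def])
qed

lemma not_bad_eventD:
  assumes "W \<in> space (side_info_measure n P Dp Dm) - bad_event n P Dp Dm \<epsilon> m"
    and "v \<in> {1..n}" "C \<in> prefix_clusters P v" "card C \<ge> m"
  shows "\<bar>(\<Sum>u\<in>C. W {u, v}) - real (card C) * mean (if same_cluster P {Min C, v} then Dp else Dm)\<bar>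
           < real (card C) * \<epsilon> (card C)"
  using assms unfolding bad_event_def deviates_def by force

text \<open>Off the bad event the tests tell the truth on large traces. So a skipped vertex is
  placed correctly, and a vertex of a large cluster is always skipped, so that \<open>abort\<close>
  never fires.\<close>

lemma mc_result:
  assumes P: "partition_on {1..n} P"
    and \<mu>: "mean Dp > mean Dm"
    and W: "W \<in> space (side_info_measure n P Dp Dm) -
              bad_event n P Dp Dm (\<lambda>_. (mean Dp - mean Dm) / 2) m"
  shows "result P (mc_tree n m (mc_tests n ((mean Dp + mean Dm) / 2) W)) = P"
proof -
  let ?T = "mc_tests n ((mean Dp + mean Dm) / 2) W"
  have test: "(C, v) \<in> ?T \<longleftrightarrow> same_cluster P {Min C, v}"
    if v: "v \<in> {1..n}" and C: "C \<in> prefix_clusters P v" and m: "card C \<ge> m" for v C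
  proof -
    have C': "C \<noteq> {}" "C \<subseteq> {1..<v}" using prefix_clusters_subset[OF C] by auto
    have mem: "(C, v) \<in> ?T \<longleftrightarrow> (\<Sum>u\<in>C. W {u, v}) > real (card C) * ((mean Dp + mean Dm) / 2)"
      using C' v by (fastforce simp: mc_tests_def)
    \<comment> \<open>The threshold is the midpoint of the means, at distance equal to the radius
      from either one.\<close>
    have half: "real (card C) * ((mean Dp + mean Dm) / 2) =
        real (card C) * mean Dp - real (card C) * ((mean Dp - mean Dm) / 2)"
      "real (card C) * ((mean Dp + mean Dm) / 2) =
        real (card C) * mean Dm + real (card C) * ((mean Dp - mean Dm) / 2)"
      by (simp_all add: field_simps)
    note good = not_bad_eventD[OF W v C m]
    show ?thesis
    proof (cases "same_cluster P {Min C, v}")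
      case True
      then have "(\<Sum>u\<in>C. W {u, v}) > real (card C) * ((mean Dp + mean Dm) / 2)"
        using good unfolding half(1) if_P[OF True] by linarith
      then show ?thesis using mem True by simp
    next
      case False
      then have "\<not> (\<Sum>u\<in>C. W {u, v}) > real (card C) * ((mean Dp + mean Dm) / 2)"
        using good unfolding half(2) if_not_P[OF False] by linarith
      then show ?thesis using mem False by simp
    qed
  qed
  have "result P (cluster_tree (mc_skip ?T m) (\<lambda>_. list_clusters) (\<lambda>C. card C \<ge> m) [1..<Suc n]
      (prefix_clusters P 1)) = P"
  proof (rule conjunct1[OF strategy.correct_run[OF strategy_mc P]])
    show "same_cluster P {Min C, u}"
      if "u \<in> {1..n}" "mc_skip ?T m u (prefix_clusters P u) = Some C" for u C
      using mc_skip_Some[OF that(2)] test that(1) by blast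
    show "\<not> m \<le> card C"
      if "u \<in> {1..n}" "mc_skip ?T m u (prefix_clusters P u) = None"
        "C \<in> prefix_clusters P u" "same_cluster P {Min C, u}" for u C
      using that test unfolding mc_skip_def by (auto split: if_splits)
  qed (rule num_queries_locate_le, auto)
  then show ?thesis by (simp add: mc_tree_def)
qed

lemma nat_ceiling_less: "x \<ge> 0 \<Longrightarrow> real (nat \<lceil>x\<rceil>) < x + 1"
  by linarith

text \<open>Failure is confined to the bad event, whose probability is at most
  \<open>n * card P * \<delta>\<close> with \<open>card P \<le> n\<close>.\<close>

lemma mc_success:
  assumes I: "clustering_instance n k P Dp Dm" and \<mu>: "mean Dp > mean Dm"
  shows "success_prob n P Dp Dm (mc_algorithm c n (mean Dp) (mean Dm)) \<ge> 1 - real n powr (- c)"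
proof (cases "n \<ge> 2")
  case False
  then have "n = 1" using I by (auto simp: clustering_instance_def)
  \<comment> \<open>For \<open>n = 1\<close> the lower bound is \<open>1 - 1 = 0\<close>.\<close>
  then show ?thesis by (simp add: success_prob_def)
next
  case True
  have P: "partition_on {1..n} P" and D: "unit_distribution Dp" "unit_distribution Dm"
    using I by (auto simp: clustering_instance_def)
  let ?M = "side_info_measure n P Dp Dm" and ?R = "run_measure n P Dp Dm"
  let ?A = "mc_algorithm c n (mean Dp) (mean Dm)"
  define \<Delta> where "\<Delta> = mean Dp - mean Dm"
  define m where "m = mc_threshold c n \<Delta>"
  define \<delta> where "\<delta> = 2 * real n powr (- (c + 3))"
  let ?B = "bad_event n P Dp Dm (\<lambda>_. \<Delta> / 2) m"
  have \<Delta>: "\<Delta> > 0" using \<mu> by (simp add: \<Delta>_def)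
  interpret M: prob_space ?M by (rule prob_space_side_info[OF D])
  interpret R: prob_space ?R
    unfolding run_measure_def
    by (rule prob_space_pair[OF prob_space_side_info[OF D] prob_space_uniform_unit])
  have tail: "2 * exp (- 2 * real s * (\<Delta> / 2)\<^sup>2) \<le> \<delta>" if "s \<ge> m" for s
  proof -
    have "2 * (c + 3) * ln (real n) / \<Delta>\<^sup>2 \<le> real m" unfolding m_def mc_threshold_def by linarith
    also have "\<dots> \<le> real s" using that by simp
    finally have "2 * (c + 3) * ln (real n) \<le> real s * \<Delta>\<^sup>2"
      using \<Delta> by (simp add: pos_divide_le_eq)
    then have "- 2 * real s * (\<Delta> / 2)\<^sup>2 \<le> - (c + 3) * ln (real n)"
      by (simp add: power_divide field_simps)
    then show ?thesis using True by (simp add: \<delta>_def powr_def)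
  qed
  have \<delta>0: "\<delta> \<ge> 0" by (simp add: \<delta>_def)
  note B = bad_event_prob[OF D P, where \<epsilon> = "\<lambda>_. \<Delta> / 2" and m = m and \<delta> = \<delta>]
  have Bs: "?B \<in> sets ?M" by (rule B(1)) (use tail \<delta>0 \<Delta> in auto)
  have "M.prob ?B \<le> real n * real (card P) * \<delta>" by (rule B(2)) (use tail \<delta>0 \<Delta> in auto)
  also have "\<dots> \<le> real n * real n * \<delta>"
    using card_partition_le[OF P] \<delta>0 by (intro mult_right_mono mult_left_mono) auto
  \<comment> \<open>The factor 2 of \<delta> is absorbed by \<open>n \<ge> 2\<close>.\<close>
  also have "\<dots> \<le> real n * real n * (real n * real n powr (- (c + 3)))"
    unfolding \<delta>_def using True by (intro mult_left_mono mult_right_mono) auto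
  also have "\<dots> = real n powr 3 * real n powr (- (c + 3))"
    using True by (simp add: power3_eq_cube)
  also have "\<dots> = real n powr (- c)" by (subst powr_add[symmetric]) simp
  finally have pB: "M.prob ?B \<le> real n powr (- c)" .
  have "1 - real n powr (- c) \<le> M.prob (space ?M - ?B)"
    using pB Bs by (simp add: M.prob_compl)
  also have "\<dots> = R.prob ((space ?M - ?B) \<times> UNIV)"
    using emeasure_run_fst(2)[OF D, of "space ?M - ?B" n P] Bs by (simp add: measure_def)
  also have "\<dots> \<le> success_prob n P Dp Dm ?A"
    unfolding success_prob_def
  proof (rule R.finite_measure_mono)
    show "(space ?M - ?B) \<times> UNIV \<subseteq> {(W, r) \<in> space ?R. result P (?A W r) = P}"
    proof
      fix x assume "x \<in> (space ?M - ?B) \<times> (UNIV :: real set)"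
      then obtain W r where x: "x = (W, r)" and W: "W \<in> space ?M - ?B" by blast
      have "result P (?A W r) = P"
        using mc_result[OF P \<mu>, of W m] W unfolding mc_algorithm_def m_def \<Delta>_def by simp
      moreover have "(W, r) \<in> space ?R"
        using W by (simp add: run_measure_def space_pair_measure space_uniform_measure)
      ultimately show "x \<in> {(W, r) \<in> space ?R. result P (?A W r) = P}" unfolding x by simp
    qed
    have "(\<lambda>(W, r). ?A W r) \<in> ?R \<rightarrow>\<^sub>M count_space UNIV"
      using valid_mc_algorithm[of n c "mean Dp" "mean Dm"] measurable_cong_sets[OF sets_run_measure[OF D] refl]
      unfolding valid_algorithm_def by blast
    then have "(\<lambda>(W, r). ?A W r) -` {t. result P t = P} \<inter> space ?R \<in> sets ?R"
      by (rule measurable_sets) simp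
    also have "(\<lambda>(W, r). ?A W r) -` {t. result P t = P} \<inter> space ?R =
        {(W, r) \<in> space ?R. result P (?A W r) = P}" by auto
    finally show "{(W, r) \<in> space ?R. result P (?A W r) = P} \<in> sets ?R" .
  qed
  finally show ?thesis .
qed

text \<open>Means lie in [0,1], so the gap is at most 1, and \<open>ln 2 \<ge> 1 / 2\<close>. This
  lets the unit of the query bounds absorb rounding and additive constants.\<close>

lemma one_le_query_unit:
  assumes D: "unit_distribution Dp" "unit_distribution Dm" and \<mu>: "mean Dp > mean Dm" and n: "n \<ge> 2"
  shows "1 \<le> 2 * (ln (real n) / (mean Dp - mean Dm)\<^sup>2)"
proof -
  let ?\<Delta> = "mean Dp - mean Dm"
  have "?\<Delta>\<^sup>2 \<le> 1"
    using mean_unit_distribution[OF D(1)] mean_unit_distribution[OF D(2)] \<mu> by (simp add: power_le_one)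
  moreover have "1 / 2 \<le> ln (2::real)" using ln2_ge_two_thirds by simp
  moreover have "ln (2::real) \<le> ln (real n)" using n by simp
  ultimately have "?\<Delta>\<^sup>2 \<le> 2 * ln (real n)" by linarith
  then show ?thesis using \<mu> by (simp add: pos_le_divide_eq)
qed

text \<open>\<open>pairs 1\<close> is empty. The case is treated apart because
  \<open>ln 1 = 0\<close> makes the Monte Carlo bound vanish.\<close>

lemma num_queries_single_vertex:
  assumes "valid_algorithm 1 A"
  shows "num_queries P (A W r) = 0"
proof -
  have "queried (A W r) = {}" using assms by (auto simp: valid_algorithm_def pairs_def)
  then show ?thesis by (rule num_queries_eq_0)
qed

lemma mc_num_queries:
  assumes I: "clustering_instance n k P Dp Dm" and \<mu>: "mean Dp > mean Dm" and c: "c > 0"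
  shows "real (num_queries P (mc_algorithm c n (mean Dp) (mean Dm) W r))
           \<le> (2 * c + 10) * ((real k)\<^sup>2 * ln (real n) / (mean Dp - mean Dm)\<^sup>2)"
proof (cases "n \<ge> 2")
  case False
  then have "n = 1" using I by (auto simp: clustering_instance_def)
  then show ?thesis using num_queries_single_vertex valid_mc_algorithm by simp
next
  case True
  have P: "partition_on {1..n} P" and D: "unit_distribution Dp" "unit_distribution Dm" and k: "card P = k"
    using I by (auto simp: clustering_instance_def)
  define \<Delta> where "\<Delta> = mean Dp - mean Dm"
  define m where "m = mc_threshold c n \<Delta>"
  define X where "X = ln (real n) / \<Delta>\<^sup>2"
  have X: "1 \<le> 2 * X" using one_le_query_unit[OF D \<mu> True] by (simp add: X_def \<Delta>_def)
  have m_eq: "m = nat \<lceil>2 * (c + 3) * X\<rceil>" by (simp add: m_def mc_threshold_def X_def)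
  have pos: "0 < 2 * (c + 3) * X" using X c by (intro mult_pos_pos) auto
  then have m1: "m \<ge> 1" unfolding m_eq by linarith
  have m_le: "real m \<le> 2 * (c + 3) * X + 1"
    using nat_ceiling_less[of "2 * (c + 3) * X"] pos unfolding m_eq by simp
  have "num_queries P (mc_algorithm c n (mean Dp) (mean Dm) W r) \<le> k * (k * m + 1)"
    unfolding mc_algorithm_def mc_tree_def k[symmetric] m_def[symmetric] \<Delta>_def[symmetric]
    by (rule strategy.num_queries_tree_start_le[OF strategy_mc P m1]) simp
  also have "k * (k * m + 1) \<le> k\<^sup>2 * (m + 1)"
    by (cases k) (auto simp: power2_eq_square algebra_simps)
  finally have "real (num_queries P (mc_algorithm c n (mean Dp) (mean Dm) W r)) \<le> real (k\<^sup>2 * (m + 1))"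
    by (rule of_nat_mono)
  also have "\<dots> = (real k)\<^sup>2 * (real m + 1)" by (simp add: algebra_simps)
  \<comment> \<open>\<open>m + 1 \<le> 2 * (c + 3) * X + 2\<close>, and
    \<open>2 \<le> 4 * X\<close>.\<close>
  also have "\<dots> \<le> (real k)\<^sup>2 * ((2 * c + 10) * X)"
    using m_le X by (intro mult_left_mono) (auto simp: algebra_simps)
  finally show ?thesis by (simp add: X_def \<Delta>_def algebra_simps)
qed

section \<open>The Las Vegas algorithm\<close>

text \<open>The subtracted radius makes Hoeffding's bound equal to \<open>2 / n ^ 4\<close> for
  every positive size. It involves neither mean.\<close>

definition lcb :: "nat \<Rightarrow> side_info \<Rightarrow> nat set \<Rightarrow> nat \<Rightarrow> real" where
  "lcb n W C v = (\<Sum>u\<in>C. W {u, v}) / real (card C) - sqrt (2 * ln (real n) / real (card C))"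

text \<open>A triple \<open>(C, C', v)\<close> says that \<open>C\<close> is at least as good as
  \<open>C'\<close> for \<open>v\<close>. An arbitrary \<open>T\<close> may have no best cluster,
  hence the default order.\<close>

definition lv_ord :: "(nat set \<times> nat set \<times> nat) set \<Rightarrow> nat \<Rightarrow> nat set set \<Rightarrow> nat set list" where
  "lv_ord T v Q =
     (if \<exists>C\<in>Q. \<forall>C'\<in>Q. (C, C', v) \<in> T
      then (let C = SOME C. C \<in> Q \<and> (\<forall>C'\<in>Q. (C, C', v) \<in> T) in C # list_clusters (Q - {C}))
      else list_clusters Q)"

definition lv_tree :: "nat \<Rightarrow> (nat set \<times> nat set \<times> nat) set \<Rightarrow> qtree" where
  "lv_tree n T = cluster_tree (\<lambda>_ _. None) (lv_ord T) (\<lambda>_. False) [1..<Suc n] {}"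

text \<open>Recording comparisons of the bounds instead of their values leaves finitely many
  outcomes.\<close>

definition lv_tests :: "nat \<Rightarrow> side_info \<Rightarrow> (nat set \<times> nat set \<times> nat) set" where
  "lv_tests n W = {x \<in> (SIGMA C:Pow {1..n}. SIGMA C':Pow {1..n}. {1..n} - (C \<union> C')).
     lcb n W (fst (snd x)) (snd (snd x)) \<le> lcb n W (fst x) (snd (snd x))}"

definition lv_algorithm :: "nat \<Rightarrow> algorithm" where
  "lv_algorithm n W r = lv_tree n (lv_tests n W)"

lemma lv_ord:
  assumes "finite Q"
  shows "set (lv_ord T v Q) = Q" "distinct (lv_ord T v Q)"
proof -
  have "set (lv_ord T v Q) = Q \<and> distinct (lv_ord T v Q)"
  proof (cases "\<exists>C\<in>Q. \<forall>C'\<in>Q. (C, C', v) \<in> T")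
    case True
    let ?C = "SOME C. C \<in> Q \<and> (\<forall>C'\<in>Q. (C, C', v) \<in> T)"
    have "?C \<in> Q \<and> (\<forall>C'\<in>Q. (?C, C', v) \<in> T)"
      by (rule someI_ex) (use True in blast)
    then have "?C \<in> Q" by blast
    moreover have "set (list_clusters (Q - {?C})) = Q - {?C} \<and> distinct (list_clusters (Q - {?C}))"
      using assms by (intro list_clusters) simp
    moreover have "lv_ord T v Q = ?C # list_clusters (Q - {?C})"
      using True by (simp add: lv_ord_def Let_def)
    ultimately show ?thesis by (simp add: insert_absorb)
  next
    case False
    then have "lv_ord T v Q = list_clusters Q" unfolding lv_ord_def by (rule if_not_P)
    then show ?thesis using list_clusters[OF assms] by simp
  qed
  then show "set (lv_ord T v Q) = Q" "distinct (lv_ord T v Q)" by blast+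
qed

lemma lv_ord_unique_best:
  assumes "C \<in> Q" and "\<And>C'. C' \<in> Q \<Longrightarrow> (C, C', v) \<in> T"
    and "\<And>C'. C' \<in> Q \<Longrightarrow> C' \<noteq> C \<Longrightarrow> (C', C, v) \<notin> T"
  shows "lv_ord T v Q = C # list_clusters (Q - {C})"
proof -
  have "(SOME C. C \<in> Q \<and> (\<forall>C'\<in>Q. (C, C', v) \<in> T)) = C"
    by (rule some_equality) (use assms in blast)+
  moreover have "\<exists>C\<in>Q. \<forall>C'\<in>Q. (C, C', v) \<in> T" using assms by blast
  ultimately show ?thesis unfolding lv_ord_def by (simp add: Let_def)
qed

lemma strategy_lv: "strategy (\<lambda>_ _. None) (lv_ord T)"
  by unfold_locales (use lv_ord in auto)

lemma valid_lv_algorithm: "valid_algorithm n (lv_algorithm n)"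
proof -
  have "valid_algorithm n (\<lambda>W r. lv_tree n (lv_tests n W))"
    unfolding lv_tests_def
  proof (rule valid_algorithm_tests)
    fix x assume x: "x \<in> (SIGMA C:Pow {1..n}. SIGMA C':Pow {1..n}. {1..n} - (C \<union> C'))"
    have [measurable]:
      "(\<lambda>W::side_info. \<Sum>u\<in>fst x. W {u, snd (snd x)}) \<in> borel_measurable (\<Pi>\<^sub>M e\<in>pairs n. borel)"
      "(\<lambda>W::side_info. \<Sum>u\<in>fst (snd x). W {u, snd (snd x)}) \<in> borel_measurable (\<Pi>\<^sub>M e\<in>pairs n. borel)"
      using x by (auto intro!: measurable_sum_side_info)
    show "{W \<in> space (\<Pi>\<^sub>M e\<in>pairs n. borel).
        lcb n W (fst (snd x)) (snd (snd x)) \<le> lcb n W (fst x) (snd (snd x))}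
        \<in> sets (\<Pi>\<^sub>M e\<in>pairs n. borel)" unfolding lcb_def by measurable
  next
    show "queried (lv_tree n X) \<subseteq> pairs n" for X
      unfolding lv_tree_def by (rule strategy.queried_tree[OF strategy_lv]) auto
  qed auto
  then show ?thesis by (simp add: lv_algorithm_def[abs_def])
qed

text \<open>Nothing is skipped and nothing aborts, so every run is correct whatever \<open>W\<close>
  is. The budget stays free: \<open>card P\<close> per vertex always works, and a finer one works
  off the bad event.\<close>

lemma lv_run:
  assumes P: "partition_on {1..n} P"
    and cost: "\<And>u f. u \<in> {1..n} \<Longrightarrow>
       num_queries P (locate u (lv_ord (lv_tests n W) u (prefix_clusters P u)) f)
         \<le> q u + num_queries P (f (matching P u (lv_ord (lv_tests n W) u (prefix_clusters P u))))"
  shows "result P (lv_algorithm n W r) = P \<and> num_queries P (lv_algorithm n W r) \<le> (\<Sum>u=1..n. q u)"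
  using strategy.correct_run[OF strategy_lv P, where abort = "\<lambda>_. False" and v = 1, OF _ _ cost]
  by (simp add: lv_algorithm_def lv_tree_def)

lemma lv_cost_le_clusters:
  assumes "finite P"
  shows "num_queries P (locate u (lv_ord T u (prefix_clusters P u)) f)
         \<le> card P + num_queries P (f (matching P u (lv_ord T u (prefix_clusters P u))))"
proof -
  have "length (lv_ord T u (prefix_clusters P u)) \<le> card P"
    using lv_ord[OF finite_prefix_clusters[OF assms, of u], of T u] card_prefix_clusters_le[OF assms, of u]
    by (metis distinct_card)
  then show ?thesis
    using num_queries_locate_le[of P u "lv_ord T u (prefix_clusters P u)" f] by linarith
qed

lemma lv_correct:
  assumes P: "partition_on {1..n} P"
  shows "result P (lv_algorithm n W r) = P" "num_queries P (lv_algorithm n W r) \<le> n * card P"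
  using lv_run[OF P lv_cost_le_clusters[OF finite_partition[OF P]]] by auto

text \<open>For a wrong cluster the subtracted radius outweighs the deviation, so its bound stays
  below \<open>mean Dm\<close>. The right one loses the radius twice, once to the deviation and once
  to the subtraction; with \<open>8 * ln n / \<Delta>\<^sup>2\<close> members the radius is at most
  \<open>\<Delta> / 2\<close>, so its bound stays above \<open>mean Dm\<close>.\<close>

lemma lv_best:
  assumes P: "partition_on {1..n} P" and \<mu>: "mean Dp > mean Dm"
    and W: "W \<in> space (side_info_measure n P Dp Dm) -
              bad_event n P Dp Dm (\<lambda>s. sqrt (2 * ln (real n) / real s)) 0"
    and v: "v \<in> {1..n}" and D: "D \<in> prefix_clusters P v" "same_cluster P {Min D, v}"
    and large: "real (card D) \<ge> 8 * ln (real n) / (mean Dp - mean Dm)\<^sup>2"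
    and C: "C \<in> prefix_clusters P v" "C \<noteq> D"
  shows "lcb n W C v < lcb n W D v"
proof -
  let ?r = "\<lambda>s. sqrt (2 * ln (real n) / real s)" and ?\<Delta> = "mean Dp - mean Dm"
  have pos: "card E > 0" if "E \<in> prefix_clusters P v" for E
    using prefix_clusters_subset[OF that] finite_subset by (auto simp: card_gt_0_iff)
  obtain E where E: "E \<in> P" "v \<in> E" using partition_onD1[OF P] v by blast
  have "\<not> same_cluster P {Min C, v}"
    using same_cluster_Min_iff[OF P E D(1)] same_cluster_Min_iff[OF P E C(1)] D(2) C(2) by simp
  then have "\<bar>(\<Sum>u\<in>C. W {u, v}) - real (card C) * mean Dm\<bar> < real (card C) * ?r (card C)"
    using not_bad_eventD[OF W v C(1)] by simp
  then have "(\<Sum>u\<in>C. W {u, v}) < real (card C) * (mean Dm + ?r (card C))"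
    by (simp add: algebra_simps)
  then have "(\<Sum>u\<in>C. W {u, v}) / real (card C) < mean Dm + ?r (card C)"
    using pos[OF C(1)] by (simp add: pos_divide_less_eq mult.commute)
  then have 1: "lcb n W C v < mean Dm" by (simp add: lcb_def)
  have "\<bar>(\<Sum>u\<in>D. W {u, v}) - real (card D) * mean Dp\<bar> < real (card D) * ?r (card D)"
    using not_bad_eventD[OF W v D(1)] D(2) by simp
  then have "real (card D) * (mean Dp - ?r (card D)) < (\<Sum>u\<in>D. W {u, v})"
    by (simp add: algebra_simps)
  then have 2: "mean Dp - ?r (card D) < (\<Sum>u\<in>D. W {u, v}) / real (card D)"
    using pos[OF D(1)] by (simp add: pos_less_divide_eq mult.commute)
  have "8 * ln (real n) \<le> real (card D) * ?\<Delta>\<^sup>2"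
    using large \<mu> by (simp add: pos_divide_le_eq)
  then have "2 * ln (real n) / real (card D) \<le> (?\<Delta> / 2)\<^sup>2"
    using pos[OF D(1)] by (simp add: pos_divide_le_eq power_divide mult.commute)
  then have "?r (card D) \<le> ?\<Delta> / 2" using \<mu> by (intro real_le_lsqrt) auto
  then show ?thesis using 1 2 unfolding lcb_def[of n W D v] by argo
qed

text \<open>At most \<open>card P * m\<close> vertices come early in their cluster and cost up to
  \<open>card P\<close> queries each. Every other vertex costs one, as its own cluster is tried
  first.\<close>

lemma lv_num_queries_good:
  assumes P: "partition_on {1..n} P" and \<mu>: "mean Dp > mean Dm"
    and m: "m \<ge> 1" "real m \<ge> 8 * ln (real n) / (mean Dp - mean Dm)\<^sup>2"
    and W: "W \<in> space (side_info_measure n P Dp Dm) -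
              bad_event n P Dp Dm (\<lambda>s. sqrt (2 * ln (real n) / real s)) 0"
  shows "num_queries P (lv_algorithm n W r) \<le> n + (card P)\<^sup>2 * m"
proof -
  let ?S = "{v. \<exists>D\<in>P. v \<in> D \<and> card (D \<inter> {1..<v}) < m}" and ?T = "lv_tests n W"
  let ?q = "\<lambda>v. if v \<in> ?S then card P else 1"
  have cost: "num_queries P (locate v (lv_ord ?T v (prefix_clusters P v)) f)
         \<le> ?q v + num_queries P (f (matching P v (lv_ord ?T v (prefix_clusters P v))))"
    if v: "v \<in> {1..n}" for v f
  proof (cases "v \<in> ?S")
    case True
    then show ?thesis using lv_cost_le_clusters[OF finite_partition[OF P]] by simp
  next
    case False
    obtain E where E: "E \<in> P" "v \<in> E" using partition_onD1[OF P] v by blast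
    define D where "D = E \<inter> {1..<v}"
    have cD: "card D \<ge> m" using False E by (auto simp: D_def not_less)
    \<comment> \<open>As \<open>m \<ge> 1\<close>, the first vertex of a cluster counts as
      early.\<close>
    then have "D \<noteq> {}" using m by auto
    then have D: "D \<in> prefix_clusters P v" using E by (auto simp: prefix_clusters_def D_def)
    then have same: "same_cluster P {Min D, v}"
      using same_cluster_Min_iff[OF P E] by (simp add: D_def)
    have large: "real (card D) \<ge> 8 * ln (real n) / (mean Dp - mean Dm)\<^sup>2"
      using cD m(2) by (meson of_nat_le_iff order_trans)
    have T: "(C, C', v) \<in> ?T \<longleftrightarrow> lcb n W C' v \<le> lcb n W C v"
      if "C \<in> prefix_clusters P v" "C' \<in> prefix_clusters P v" for C C'
      using prefix_clusters_subset[OF that(1)] prefix_clusters_subset[OF that(2)] v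
      by (fastforce simp: lv_tests_def)
    have best: "lcb n W C v < lcb n W D v" if "C \<in> prefix_clusters P v" "C \<noteq> D" for C
      using lv_best[OF P \<mu> W v D same large that] .
    have "lv_ord ?T v (prefix_clusters P v) = D # list_clusters (prefix_clusters P v - {D})"
    proof (rule lv_ord_unique_best[OF D])
      show "(D, C', v) \<in> ?T" if "C' \<in> prefix_clusters P v" for C'
        using T[OF D that] best[OF that] by (cases "C' = D") auto
      show "(C', D, v) \<notin> ?T" if "C' \<in> prefix_clusters P v" "C' \<noteq> D" for C'
        using T[OF that(1) D] best[OF that] by auto
    qed
    then show ?thesis using same by (subst if_not_P[OF False]) simp
  qed
  have "num_queries P (lv_algorithm n W r) \<le> (\<Sum>v=1..n. ?q v)"
    using lv_run[OF P cost] by blast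
  also have "\<dots> \<le> (\<Sum>v=1..n. 1 + (if v \<in> ?S then card P else 0))"
    by (rule sum_mono) auto
  also have "\<dots> = n + card ({1..n} \<inter> ?S) * card P"
    by (subst sum.distrib, subst sum.If_cases) auto
  also have "\<dots> \<le> n + (card P * m) * card P"
  proof -
    have "?S \<subseteq> {1..n}" using partition_onD1[OF P] by blast
    then have "{1..n} \<inter> ?S = ?S" by blast
    then show ?thesis using card_early_vertices_le[OF P, of m] by simp
  qed
  also have "\<dots> = n + (card P)\<^sup>2 * m" by (simp add: power2_eq_square)
  finally show ?thesis .
qed

text \<open>The bad event has probability at most \<open>2 / n ^ 2\<close> and costs at most
  \<open>n * k \<le> n ^ 2\<close> queries, so it adds at most 2 to the expectation.\<close>

lemma lv_expected_queries:
  assumes I: "clustering_instance n k P Dp Dm" and \<mu>: "mean Dp > mean Dm"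
  shows "expected_queries n P Dp Dm (lv_algorithm n)
           \<le> ennreal (10 * (real n + (real k)\<^sup>2 * ln (real n) / (mean Dp - mean Dm)\<^sup>2))"
proof (cases "n \<ge> 2")
  case False
  then have n1: "n = 1" using I by (auto simp: clustering_instance_def)
  then have "num_queries P (lv_algorithm n W r) = 0" for W r
    using num_queries_single_vertex valid_lv_algorithm by simp
  then show ?thesis by (simp add: expected_queries_def case_prod_unfold)
next
  case True
  have P: "partition_on {1..n} P" and D: "unit_distribution Dp" "unit_distribution Dm" and k: "card P = k"
    using I by (auto simp: clustering_instance_def)
  have kn: "k \<le> n" using card_partition_le[OF P] k by simp
  let ?M = "side_info_measure n P Dp Dm" and ?R = "run_measure n P Dp Dm"
  let ?\<epsilon> = "\<lambda>s. sqrt (2 * ln (real n) / real s)"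
  let ?B = "bad_event n P Dp Dm ?\<epsilon> 0"
  define X where "X = ln (real n) / (mean Dp - mean Dm)\<^sup>2"
  define m where "m = nat \<lceil>8 * X\<rceil>"
  have X: "1 \<le> 2 * X" using one_le_query_unit[OF D \<mu> True] by (simp add: X_def)
  have m1: "m \<ge> 1" and mX: "real m \<ge> 8 * X" unfolding m_def using X by linarith+
  have m_le: "real m \<le> 10 * X" using nat_ceiling_less[of "8 * X"] X unfolding m_def by simp
  interpret M: prob_space ?M by (rule prob_space_side_info[OF D])
  interpret R: prob_space ?R
    unfolding run_measure_def
    by (rule prob_space_pair[OF prob_space_side_info[OF D] prob_space_uniform_unit])
  have ln0: "ln (real n) \<ge> 0" using True by simp
  have tail: "2 * exp (- 2 * real s * (?\<epsilon> s)\<^sup>2) \<le> 2 / real n ^ 4" if "s \<ge> 1" for s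
  proof -
    have "- 2 * real s * (?\<epsilon> s)\<^sup>2 = - (4 * ln (real n))" using that ln0 by simp
    moreover have "exp (- (4 * ln (real n))) = 1 / real n ^ 4"
    proof -
      have "exp (4 * ln (real n)) = real n ^ 4"
        using exp_of_nat_mult[of 4 "ln (real n)"] True by simp
      then show ?thesis by (simp add: exp_minus inverse_eq_divide)
    qed
    ultimately have "exp (- 2 * real s * (?\<epsilon> s)\<^sup>2) = 1 / real n ^ 4" by presburger
    then show ?thesis by simp
  qed
  note B = bad_event_prob[OF D P, where \<epsilon> = ?\<epsilon> and m = 0 and \<delta> = "2 / real n ^ 4"]
  have Bs: "?B \<in> sets ?M" by (rule B(1)) (use tail ln0 in auto)
  have "M.prob ?B \<le> real n * real (card P) * (2 / real n ^ 4)" by (rule B(2)) (use tail ln0 in auto)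
  also have "\<dots> \<le> real n * real n * (2 / real n ^ 4)"
    using kn k by (intro mult_right_mono mult_left_mono) auto
  also have "\<dots> = 2 / (real n)\<^sup>2" using True by (simp add: field_simps power2_eq_square power4_eq_xxxx)
  finally have pB: "(real n)\<^sup>2 * M.prob ?B \<le> 2"
    using True by (simp add: pos_le_divide_eq mult.commute)
  have "expected_queries n P Dp Dm (lv_algorithm n)
      \<le> (\<integral>\<^sup>+ x. ennreal (real n + (real k)\<^sup>2 * real m) + ennreal ((real n)\<^sup>2) * indicator (?B \<times> UNIV) x \<partial>?R)"
    unfolding expected_queries_def
  proof (rule nn_integral_mono, clarify)
    fix W r assume "(W, r) \<in> space ?R"
    then have W: "W \<in> space ?M" by (simp add: run_measure_def space_pair_measure)
    let ?N = "num_queries P (lv_algorithm n W r)"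
    have e: "of_nat ?N = ennreal (real ?N)" by (simp add: ennreal_of_nat_eq_real_of_nat)
    show "of_nat ?N \<le> ennreal (real n + (real k)\<^sup>2 * real m) +
        ennreal ((real n)\<^sup>2) * indicator (?B \<times> UNIV) (W, r)"
    proof (cases "W \<in> ?B")
      case True
      have "?N \<le> n * card P" by (rule lv_correct(2)[OF P])
      also have "\<dots> \<le> n\<^sup>2" using kn k by (simp add: power2_eq_square)
      finally have "real ?N \<le> real (n\<^sup>2)" by (rule of_nat_mono)
      then have "of_nat ?N \<le> ennreal ((real n)\<^sup>2)" unfolding e by (intro ennreal_leI) simp
      also have "\<dots> \<le> ennreal (real n + (real k)\<^sup>2 * real m) + ennreal ((real n)\<^sup>2)" by simp
      finally show ?thesis using True by simp
    next
      case False
      have "?N \<le> n + (card P)\<^sup>2 * m"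
        by (rule lv_num_queries_good[OF P \<mu> m1]) (use mX W False in \<open>auto simp: X_def\<close>)
      then have "real ?N \<le> real (n + k\<^sup>2 * m)" unfolding k by (rule of_nat_mono)
      then have "of_nat ?N \<le> ennreal (real n + (real k)\<^sup>2 * real m)" unfolding e by (intro ennreal_leI) simp
      then show ?thesis using False by simp
    qed
  qed
  also have "\<dots> = ennreal (real n + (real k)\<^sup>2 * real m) + ennreal ((real n)\<^sup>2) * emeasure ?R (?B \<times> UNIV)"
    using emeasure_run_fst(1)[OF D Bs] R.emeasure_space_1
    by (simp add: nn_integral_add nn_integral_cmult)
  also have "\<dots> = ennreal (real n + (real k)\<^sup>2 * real m + (real n)\<^sup>2 * M.prob ?B)"
    unfolding emeasure_run_fst(2)[OF D Bs] M.emeasure_eq_measure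
    by (simp add: ennreal_mult ennreal_plus)
  \<comment> \<open>The constant 10 comes from \<open>m \<le> 8 * X + 1 \<le> 10 * X\<close>; the
    additive 2 is covered by \<open>n\<close>.\<close>
  also have "\<dots> \<le> ennreal (10 * (real n + (real k)\<^sup>2 * X))"
  proof (rule ennreal_leI)
    have "(real k)\<^sup>2 * real m \<le> (real k)\<^sup>2 * (10 * X)" using m_le by (intro mult_left_mono) auto
    moreover have "2 \<le> real n" using True by simp
    ultimately show "real n + (real k)\<^sup>2 * real m + (real n)\<^sup>2 * M.prob ?B \<le> 10 * (real n + (real k)\<^sup>2 * X)"
      using pB by (simp add: algebra_simps)
  qed
  finally show ?thesis by (simp add: X_def)
qed

text \<open>Unknown means are expressed by the type of the second algorithm, which receives
  \<open>n\<close> only.\<close>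

theorem theorem3:
  "(\<forall>c>0. \<exists>(A :: nat \<Rightarrow> real \<Rightarrow> real \<Rightarrow> algorithm) (C :: real).
      (\<forall>n \<mu>p \<mu>m. valid_algorithm n (A n \<mu>p \<mu>m)) \<and>
      (\<forall>n k P Dp Dm. clustering_instance n k P Dp Dm \<longrightarrow> mean Dp > mean Dm \<longrightarrow>
         success_prob n P Dp Dm (A n (mean Dp) (mean Dm)) \<ge> 1 - real n powr (- c) \<and>
         (\<forall>(W, r) \<in> inputs n.
            real (num_queries P (A n (mean Dp) (mean Dm) W r))
              \<le> C * ((real k)\<^sup>2 * ln (real n) / (mean Dp - mean Dm)\<^sup>2)))) \<and>
   (\<exists>(A :: nat \<Rightarrow> algorithm) (C :: real).
      (\<forall>n. valid_algorithm n (A n)) \<and>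
      (\<forall>n\<ge>1. \<forall>P. partition_on {1..n} P \<longrightarrow>
         (\<forall>(W, r) \<in> inputs n. result P (A n W r) = P)) \<and>
      (\<forall>n k P Dp Dm. clustering_instance n k P Dp Dm \<longrightarrow> mean Dp > mean Dm \<longrightarrow>
         expected_queries n P Dp Dm (A n)
           \<le> ennreal (C * (real n + (real k)\<^sup>2 * ln (real n) / (mean Dp - mean Dm)\<^sup>2))))"
proof (intro conjI allI impI)
  fix c :: real assume "c > 0"
  then show "\<exists>(A :: nat \<Rightarrow> real \<Rightarrow> real \<Rightarrow> algorithm) (C :: real).
      (\<forall>n \<mu>p \<mu>m. valid_algorithm n (A n \<mu>p \<mu>m)) \<and>
      (\<forall>n k P Dp Dm. clustering_instance n k P Dp Dm \<longrightarrow> mean Dp > mean Dm \<longrightarrow>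
         success_prob n P Dp Dm (A n (mean Dp) (mean Dm)) \<ge> 1 - real n powr (- c) \<and>
         (\<forall>(W, r) \<in> inputs n.
            real (num_queries P (A n (mean Dp) (mean Dm) W r))
              \<le> C * ((real k)\<^sup>2 * ln (real n) / (mean Dp - mean Dm)\<^sup>2)))"
    using valid_mc_algorithm mc_success mc_num_queries
    by (intro exI[of _ "mc_algorithm c"] exI[of _ "2 * c + 10"]) auto
next
  show "\<exists>(A :: nat \<Rightarrow> algorithm) (C :: real).
      (\<forall>n. valid_algorithm n (A n)) \<and>
      (\<forall>n\<ge>1. \<forall>P. partition_on {1..n} P \<longrightarrow>
         (\<forall>(W, r) \<in> inputs n. result P (A n W r) = P)) \<and>
      (\<forall>n k P Dp Dm. clustering_instance n k P Dp Dm \<longrightarrow> mean Dp > mean Dm \<longrightarrow>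
         expected_queries n P Dp Dm (A n)
           \<le> ennreal (C * (real n + (real k)\<^sup>2 * ln (real n) / (mean Dp - mean Dm)\<^sup>2)))"
    using valid_lv_algorithm lv_correct(1) lv_expected_queries
    by (intro exI[of _ lv_algorithm] exI[of _ 10]) auto
qed

end
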